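(* Let $H$ be an infinite-dimensional separable complex Hilbert space, and define $$\widehat{\beta_0}(H):=\{T\in\beta_0(H): T+K\in\beta_0(H)\text{ for every }K\in\mathcal{K}(H)\}.$$ Then $\widehat{\beta_0}(H)=\mathcal{K}(H)$.
   Context: $\mathcal{B}(H)$ is the algebra of bounded linear operators on $H$ and $\mathcal{K}(H)$ is the ideal of compact operators on $H$. A closed subspace $M\subseteq H$ is reducing for $T\in\mathcal{B}(H)$ if $TM\subseteq M$ and $TM^\perp\subseteq M^\perp$; $\mathcal{R}_T$ denotes the collection of all reducing subspaces of $T$. For $M\in\mathcal{R}_T$ non-zero, the restriction $T|_M$ is norm attaining if there is a unit vector $x\in M$ with $\|Tx\|=\|T|_M\|$, where $\|T|_M\|=\sup\{\|Ty\|:y\in M,\|y\|=1\}$. Put $|T|:=(T^*T)^{1/2}$ and $$\beta(H):=\{T\in\mathcal{B}(H): T|_M \text{ is norm attaining for every non-zero } M\in\mathcal{R}_T\},\qquad \beta_0(H):=\{T\in\mathcal{B}(H): |T|\in\beta(H)\}.$$ *)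

theory Defs
  imports "HOL-Analysis.Analysis"
begin

text \<open>
  Complex Hilbert spaces, as a class on top of the real Hilbert spaces of the library: the
  real inner product is the real part of the complex one, so the library's norm and topology
  are those of the complex Hilbert space.  Positive definiteness of \<open>cinner\<close> and
  completeness are inherited.  The inner product is linear in its first argument.
\<close>

class complex_hilbert_space = real_inner + complete_space +
  fixes scaleC :: "complex \<Rightarrow> 'a \<Rightarrow> 'a"  (infixr \<open>*\<^sub>C\<close> 75)
    and cinner :: "'a \<Rightarrow> 'a \<Rightarrow> complex"
  assumes scaleC_add_right: "a *\<^sub>C (x + y) = a *\<^sub>C x + a *\<^sub>C y"
    and scaleC_add_left: "(a + b) *\<^sub>C x = a *\<^sub>C x + b *\<^sub>C x"
    and scaleC_scaleC: "a *\<^sub>C b *\<^sub>C x = (a * b) *\<^sub>C x"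
    and scaleR_scaleC: "r *\<^sub>R x = complex_of_real r *\<^sub>C x"
    and cinner_commute: "cinner x y = cnj (cinner y x)"
    and cinner_add_left: "cinner (x + y) z = cinner x z + cinner y z"
    and cinner_scaleC_left: "cinner (a *\<^sub>C x) y = a * cinner x y"
    and inner_eq_Re_cinner: "inner x y = Re (cinner x y)"

lemma cinner_self: "cinner x x = complex_of_real ((norm x)\<^sup>2)"
proof (rule complex_eqI)
  show "Re (cinner x x) = Re (complex_of_real ((norm x)\<^sup>2))"
    by (simp add: power2_norm_eq_inner inner_eq_Re_cinner)
  have "Im (cinner x x) = - Im (cinner x x)"
    using cinner_commute[of x x] by (metis cnj.simps(2))
  then show "Im (cinner x x) = Im (complex_of_real ((norm x)\<^sup>2))"
    by simp
qed

global_interpretation complex_vector: vector_space "scaleC :: complex \<Rightarrow> 'a \<Rightarrow> 'a::complex_hilbert_space"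
  defines csubspace = complex_vector.subspace and cspan = complex_vector.span
proof
  fix x :: 'a
  show "1 *\<^sub>C x = x"
    using scaleR_scaleC[of 1 x] by simp
qed (simp_all add: scaleC_add_right scaleC_add_left scaleC_scaleC)

definition bounded_clinear :: "('a::complex_hilbert_space \<Rightarrow> 'a) \<Rightarrow> bool" where
  "bounded_clinear T \<longleftrightarrow> bounded_linear T \<and> (\<forall>c x. T (c *\<^sub>C x) = c *\<^sub>C T x)"

definition bounded_operators :: "('a::complex_hilbert_space \<Rightarrow> 'a) set" where
  "bounded_operators = {T. bounded_clinear T}"

definition compact_operators :: "('a::complex_hilbert_space \<Rightarrow> 'a) set" where
  "compact_operators = {K \<in> bounded_operators. compact (closure (K ` cball 0 1))}"

definition orth_compl :: "'a::complex_hilbert_space set \<Rightarrow> 'a set" where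
  "orth_compl M = {y. \<forall>x\<in>M. cinner x y = 0}"

definition reducing_subspaces :: "('a::complex_hilbert_space \<Rightarrow> 'a) \<Rightarrow> 'a set set" where
  "reducing_subspaces T =
    {M. csubspace M \<and> closed M \<and> T ` M \<subseteq> M \<and> T ` orth_compl M \<subseteq> orth_compl M}"

definition norm_on :: "('a::complex_hilbert_space \<Rightarrow> 'a) \<Rightarrow> 'a set \<Rightarrow> real" where
  "norm_on T M = (SUP y\<in>{y \<in> M. norm y = 1}. norm (T y))"

definition norm_attaining_on :: "('a::complex_hilbert_space \<Rightarrow> 'a) \<Rightarrow> 'a set \<Rightarrow> bool" where
  "norm_attaining_on T M \<longleftrightarrow> (\<exists>x\<in>M. norm x = 1 \<and> norm (T x) = norm_on T M)"

text \<open>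
  The adjoint and the positive square root exist and are unique for bounded operators and
  for positive bounded operators, respectively; elsewhere the values are unspecified.
\<close>

definition adjoint_op :: "('a::complex_hilbert_space \<Rightarrow> 'a) \<Rightarrow> 'a \<Rightarrow> 'a" where
  "adjoint_op T = (THE S. S \<in> bounded_operators \<and> (\<forall>x y. cinner (T x) y = cinner x (S y)))"

definition positive_operators :: "('a::complex_hilbert_space \<Rightarrow> 'a) set" where
  "positive_operators =
    {P \<in> bounded_operators. \<forall>x. cinner (P x) x \<in> \<real> \<and> 0 \<le> Re (cinner (P x) x)}"

definition sqrt_op :: "('a::complex_hilbert_space \<Rightarrow> 'a) \<Rightarrow> 'a \<Rightarrow> 'a" where
  "sqrt_op A = (THE P. P \<in> positive_operators \<and> P \<circ> P = A)"

definition abs_op :: "('a::complex_hilbert_space \<Rightarrow> 'a) \<Rightarrow> 'a \<Rightarrow> 'a" where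
  "abs_op T = sqrt_op (adjoint_op T \<circ> T)"

definition beta :: "('a::complex_hilbert_space \<Rightarrow> 'a) set" where
  "beta = {T \<in> bounded_operators.
    \<forall>M \<in> reducing_subspaces T. M \<noteq> {0} \<longrightarrow> norm_attaining_on T M}"

definition beta0 :: "('a::complex_hilbert_space \<Rightarrow> 'a) set" where
  "beta0 = {T \<in> bounded_operators. abs_op T \<in> beta}"

definition beta0_hat :: "('a::complex_hilbert_space \<Rightarrow> 'a) set" where
  "beta0_hat = {T \<in> beta0. \<forall>K \<in> compact_operators. (\<lambda>x. T x + K x) \<in> beta0}"

end

theory Submission
  imports Defs
begin

text \<open>
  Write \<open>P\<close> for \<open>abs_op T\<close>, so that \<open>P\<close> is positive and \<open>norm (P x) = norm (T x)\<close>.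

  If \<open>T\<close> is compact, a maximising sequence of unit vectors \<open>y n\<close> for \<open>P\<close> on a reducing subspace is
  an approximate eigensequence of \<open>P \<circ> P\<close>. As \<open>P \<circ> P\<close> is the adjoint of \<open>T\<close> composed with \<open>T\<close>,
  compactness makes a subsequence of \<open>P (P (y n))\<close> converge, hence a subsequence of \<open>y n\<close>, and the
  norm is attained at its limit (\<open>compact_operator_abs_op_norm_attaining\<close>). Sums of compact operators
  are compact, so compact operators stay in \<open>beta0\<close> under compact perturbations.

  Conversely, let \<open>P \<in> beta\<close>. A vector at which \<open>P\<close> attains its norm on a reducing subspace is an
  eigenvector, and the orthogonal complement of eigenvectors is again reducing. Splitting off one
  maximal eigenvector after another gives an orthonormal sequence \<open>e n\<close> with decreasing eigenvalues
  \<open>l n\<close>, where \<open>l n\<close> bounds \<open>P\<close> on the complement of the earlier vectors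
  (\<open>eigenvector_sequence\<close>). If \<open>l\<close> tends to \<open>0\<close>, then \<open>T\<close> is a norm limit of operators of
  finite rank and therefore compact. If \<open>l\<close> tends to some \<open>\<alpha> > 0\<close>, then \<open>T\<close> can be moved out of
  \<open>beta0\<close>: on a subsequence along which \<open>l\<close> converges geometrically fast, replace the eigenvalues
  by numbers that increase strictly to \<open>\<alpha>\<close>. This is a compact perturbation, because the relative
  change of the eigenvalues is summable, and on the closed span of the subsequence the new absolute
  value does not attain its norm \<open>\<alpha>\<close> (\<open>compact_perturbation_not_beta0\<close>).

  Both directions need \<open>abs_op T\<close> to be what its name says, that is, existence of adjoints and
  existence and uniqueness of positive square roots. These are real Hilbert space facts: the
  adjoint comes from the Riesz representation theorem, the square root from a fixed point
  iteration, and complex linearity of the root follows since it commutes with everything that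
  commutes with the given operator.
\<close>

section \<open>The Riesz representation theorem and adjoints\<close>

text \<open>
  The first order condition at a minimum: a quadratic polynomial in \<open>t\<close> that vanishes at \<open>0\<close> and is
  nowhere negative has no linear term.
\<close>

lemma linear_coeff_zero_if_quadratic_nonneg:
  fixes b c :: real
  assumes "\<And>t. 0 \<le> 2 * t * b + t\<^sup>2 * c"
  shows "b = 0"
proof (rule ccontr)
  assume "b \<noteq> 0"
  \<comment> \<open>For \<open>t = - b / k\<close> with \<open>k > c\<close> the linear term outweighs the quadratic one.\<close>
  define k where "k = \<bar>c\<bar> + 1"
  have k: "k > 0" "c < k"
    by (auto simp: k_def)
  have "0 \<le> 2 * (- b / k) * b + (- b / k)\<^sup>2 * c"
    by (rule assms)
  also have "\<dots> = (b / k)\<^sup>2 * (c - 2 * k)"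
    using k by (simp add: field_simps power2_eq_square)
  also have "\<dots> < 0"
    using k \<open>b \<noteq> 0\<close> by (intro mult_pos_neg) auto
  finally show False
    by simp
qed

text \<open>
  The representing vector is the minimiser of the energy \<open>inner x x - 2 * f x\<close>: the parallelogram law
  makes every minimising sequence Cauchy, and the first order condition at the limit is the claim.
\<close>

lemma riesz_representation:
  fixes f :: "'a::{real_inner,banach} \<Rightarrow> real"
  assumes "bounded_linear f"
  shows "\<exists>z. \<forall>y. f y = inner z y"
proof -
  interpret f: bounded_linear f by fact
  obtain K where K: "\<And>x. \<bar>f x\<bar> \<le> norm x * K"
    using f.bounded by (auto simp: real_norm_def)
  define E where "E x = inner x x - 2 * f x" for x
  have E_lower: "- K\<^sup>2 \<le> E x" for x
  proof -
    have "0 \<le> (norm x - K)\<^sup>2"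
      by simp
    moreover have "f x \<le> norm x * K"
      using K[of x] by simp
    ultimately show ?thesis
      by (simp add: E_def power2_norm_eq_inner[symmetric] power2_diff)
  qed
  define m where "m = Inf (range E)"
  have m_le: "m \<le> E x" for x
    unfolding m_def by (rule cInf_lower) (auto intro!: bdd_belowI2 E_lower)
  have "\<exists>x. E x < m + inverse (real (Suc n))" for n
    using cInf_lessD[of "range E" "m + inverse (real (Suc n))"] by (auto simp: m_def)
  then obtain x where x: "\<And>n. E (x n) < m + inverse (real (Suc n))"
    by metis
  have parallelogram: "(norm (u - v))\<^sup>2 \<le> 2 * (E u - m) + 2 * (E v - m)" for u v
  proof -
    have "(norm (u - v))\<^sup>2 = 2 * E u + 2 * E v - 4 * E ((1/2) *\<^sub>R (u + v))"
      unfolding E_def power2_norm_eq_inner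
      by (simp add: f.scaleR f.add inner_add_left inner_add_right inner_diff_left
          inner_diff_right inner_commute algebra_simps)
    with m_le[of "(1/2) *\<^sub>R (u + v)"] show ?thesis
      by simp
  qed
  have "Cauchy x"
  proof (rule metric_CauchyI)
    fix e :: real assume "e > 0"
    then obtain N where N: "inverse (real (Suc N)) < e\<^sup>2 / 4"
      using reals_Archimedean[of "e\<^sup>2 / 4"] by auto
    have close: "E (x i) - m < e\<^sup>2 / 4" if "N \<le> i" for i
    proof -
      have "inverse (real (Suc i)) \<le> inverse (real (Suc N))"
        using that by (intro le_imp_inverse_le) auto
      then have "inverse (real (Suc i)) < e\<^sup>2 / 4"
        using N by (rule le_less_trans)
      with x[of i] show ?thesis
        by linarith
    qed
    show "\<exists>M. \<forall>i\<ge>M. \<forall>j\<ge>M. dist (x i) (x j) < e"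
    proof (intro exI[of _ N] allI impI)
      fix i j assume "N \<le> i" "N \<le> j"
      have "(norm (x i - x j))\<^sup>2 \<le> 2 * (E (x i) - m) + 2 * (E (x j) - m)"
        by (rule parallelogram)
      also have "\<dots> < 2 * (e\<^sup>2 / 4) + 2 * (e\<^sup>2 / 4)"
        by (intro add_strict_mono mult_strict_left_mono close \<open>N \<le> i\<close> \<open>N \<le> j\<close>) simp_all
      finally have "(norm (x i - x j))\<^sup>2 < e\<^sup>2"
        by simp
      then show "dist (x i) (x j) < e"
        using \<open>e > 0\<close> by (simp add: dist_norm power2_less_imp_less)
    qed
  qed
  then obtain z where z: "x \<longlonglongrightarrow> z"
    using Cauchy_convergent convergent_def by blast
  have Ez: "E z \<le> m"
  proof (rule LIMSEQ_le)
    show "(\<lambda>n. E (x n)) \<longlonglongrightarrow> E z"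
      unfolding E_def by (intro tendsto_intros z f.tendsto)
    show "(\<lambda>n. m + inverse (real (Suc n))) \<longlonglongrightarrow> m"
      using tendsto_add[OF tendsto_const LIMSEQ_inverse_real_of_nat, of m] by simp
    show "\<exists>N. \<forall>n\<ge>N. E (x n) \<le> m + inverse (real (Suc n))"
      using x by (auto intro: less_imp_le)
  qed
  have "inner z y - f y = 0" for y
  proof (rule linear_coeff_zero_if_quadratic_nonneg)
    fix t
    have "E (z + t *\<^sub>R y) - E z = 2 * t * (inner z y - f y) + t\<^sup>2 * inner y y"
      unfolding E_def
      by (simp add: f.scaleR f.add inner_add_left inner_add_right inner_commute
          power2_eq_square algebra_simps)
    with m_le[of "z + t *\<^sub>R y"] Ez
    show "0 \<le> 2 * t * (inner z y - f y) + t\<^sup>2 * inner y y"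
      by linarith
  qed
  then have "f y = inner z y" for y
    by simp
  then show ?thesis
    by blast
qed

lemma norm_adjoint_le:
  fixes T S :: "'a::real_inner \<Rightarrow> 'a"
  assumes adj: "\<And>x y. inner (T x) y = inner x (S y)"
    and bound: "\<And>x. norm (T x) \<le> K * norm x" and "0 \<le> K"
  shows "norm (S y) \<le> K * norm y"
proof (cases "S y = 0")
  case False
  have "norm (S y) * norm (S y) = inner (T (S y)) y"
    by (simp add: adj power2_norm_eq_inner[symmetric] power2_eq_square)
  also have "\<dots> \<le> norm (T (S y)) * norm y"
    by (rule norm_cauchy_schwarz)
  also have "\<dots> \<le> (K * norm (S y)) * norm y"
    by (intro mult_right_mono bound) auto
  finally show ?thesis
    using False by (simp add: mult_ac)
qed (simp add: \<open>0 \<le> K\<close>)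

lemma real_adjoint_exists:
  fixes T :: "'a::{real_inner,banach} \<Rightarrow> 'a"
  assumes "bounded_linear T"
  shows "\<exists>S. bounded_linear S \<and> (\<forall>x y. inner (T x) y = inner x (S y))"
proof -
  interpret T: bounded_linear T by fact
  have "\<exists>z. \<forall>x. inner (T x) y = inner z x" for y
    by (intro riesz_representation bounded_linear_compose[OF bounded_linear_inner_left assms])
  then obtain S where S: "\<And>x y. inner (T x) y = inner x (S y)"
    by (metis inner_commute)
  obtain K where K: "K \<ge> 0" "\<And>x. norm (T x) \<le> norm x * K"
    using T.nonneg_bounded by blast
  have "bounded_linear S"
  proof (rule bounded_linear_intro)
    show "S (x + y) = S x + S y" for x y
      using vector_eq_ldot[of "S (x + y)" "S x + S y"] by (simp add: S[symmetric] inner_add_right)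
    show "S (r *\<^sub>R x) = r *\<^sub>R S x" for r x
      using vector_eq_ldot[of "S (r *\<^sub>R x)" "r *\<^sub>R S x"] by (simp add: S[symmetric])
    show "norm (S x) \<le> norm x * K" for x
      using norm_adjoint_le[OF S, of K x] K by (simp add: mult.commute)
  qed
  with S show ?thesis
    by blast
qed

section \<open>Square roots of positive operators\<close>

text \<open>
  With \<open>A = 1 - S\<close>, an operator \<open>B\<close> with \<open>2 B = A + B\<^sup>2\<close> gives the root \<open>1 - B\<close> of \<open>S\<close>. The iteration
  \<open>B \<mapsto> (A + B\<^sup>2) / 2\<close> from \<open>0\<close> consists of polynomials in \<open>A\<close> with non-negative coefficients, so for
  \<open>norm A \<le> 1\<close> all estimates are dominated by the scalar iteration with \<open>A = 1\<close>, which is the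
  following sequence. It converges, even though the iteration is then no strict contraction.
\<close>

primrec sqrt_majorant :: "nat \<Rightarrow> real" where
  "sqrt_majorant 0 = 0"
| "sqrt_majorant (Suc n) = (1 + (sqrt_majorant n)\<^sup>2) / 2"

primrec sqrt_iter :: "('a::real_normed_vector \<Rightarrow>\<^sub>L 'a) \<Rightarrow> nat \<Rightarrow> 'a \<Rightarrow>\<^sub>L 'a" where
  "sqrt_iter A 0 = 0"
| "sqrt_iter A (Suc n) = (1/2) *\<^sub>R (A + (sqrt_iter A n o\<^sub>L sqrt_iter A n))"

lemma sqrt_majorant_range: "0 \<le> sqrt_majorant n \<and> sqrt_majorant n \<le> 1"
  by (induction n) (auto simp: power_le_one)

lemma incseq_sqrt_majorant: "incseq sqrt_majorant"
proof (rule incseq_SucI)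
  fix n
  have "0 \<le> (1 - sqrt_majorant n)\<^sup>2"
    by simp
  then show "sqrt_majorant n \<le> sqrt_majorant (Suc n)"
    by (simp add: power2_eq_square algebra_simps)
qed

lemma Cauchy_sqrt_majorant: "Cauchy sqrt_majorant"
proof -
  obtain L where "sqrt_majorant \<longlonglongrightarrow> L"
    using incseq_convergent[OF incseq_sqrt_majorant, of 1] sqrt_majorant_range by metis
  then show ?thesis
    by (rule LIMSEQ_imp_Cauchy)
qed

interpretation blinfun_comp: bounded_bilinear "(o\<^sub>L)"
  by (rule bounded_bilinear_blinfun_compose)

lemma sqrt_iter_commute:
  assumes "C o\<^sub>L A = A o\<^sub>L C"
  shows "C o\<^sub>L sqrt_iter A n = sqrt_iter A n o\<^sub>L C"
proof (induction n)
  case (Suc n)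
  have "C (sqrt_iter A n x) = sqrt_iter A n (C x)" for x
    using arg_cong[OF Suc, of "\<lambda>F. F x"] by simp
  then have "C o\<^sub>L (sqrt_iter A n o\<^sub>L sqrt_iter A n) = (sqrt_iter A n o\<^sub>L sqrt_iter A n) o\<^sub>L C"
    by (intro blinfun_eqI) simp
  then show ?case
    using assms by (simp add: blinfun_comp.add_left blinfun_comp.add_right
        blinfun_comp.scaleR_left blinfun_comp.scaleR_right)
qed (simp add: blinfun_comp.zero_left blinfun_comp.zero_right)

lemma norm_sqrt_iter_le:
  assumes "norm A \<le> 1"
  shows "norm (sqrt_iter A n) \<le> sqrt_majorant n"
proof (induction n)
  case (Suc n)
  have "norm (A + (sqrt_iter A n o\<^sub>L sqrt_iter A n))
      \<le> norm A + norm (sqrt_iter A n) * norm (sqrt_iter A n)"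
    by (rule order_trans[OF norm_triangle_ineq add_left_mono[OF norm_blinfun_compose]])
  also have "\<dots> \<le> 1 + sqrt_majorant n * sqrt_majorant n"
    using assms Suc sqrt_majorant_range by (intro add_mono mult_mono) auto
  finally show ?case
    by (simp add: power2_eq_square)
qed simp

text \<open>
  Both sides satisfy the same recursion: iterates commute, so a difference of squares factors as
  \<open>(B (n + 1) + B n) (B (n + 1) - B n)\<close>, and the two factors are dominated by their scalar analogues.
\<close>

lemma norm_sqrt_iter_Suc_diff_le:
  assumes "norm A \<le> 1"
  shows "norm (sqrt_iter A (Suc n) - sqrt_iter A n) \<le> sqrt_majorant (Suc n) - sqrt_majorant n"
proof (induction n)
  case 0
  then show ?case
    using norm_sqrt_iter_le[OF assms, of 1] by (simp add: blinfun_comp.zero_left)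
next
  case (Suc n)
  let ?B = "sqrt_iter A" and ?s = "sqrt_majorant"
  have comm: "?B n o\<^sub>L ?B (Suc n) = ?B (Suc n) o\<^sub>L ?B n"
    by (rule sqrt_iter_commute, rule sqrt_iter_commute[symmetric], rule refl)
  have "?B (Suc (Suc n)) - ?B (Suc n)
      = (1/2) *\<^sub>R ((?B (Suc n) o\<^sub>L ?B (Suc n)) - (?B n o\<^sub>L ?B n))"
    by (simp add: algebra_simps)
  also have "\<dots> = (1/2) *\<^sub>R ((?B (Suc n) + ?B n) o\<^sub>L (?B (Suc n) - ?B n))"
    unfolding blinfun_comp.add_left blinfun_comp.diff_right comm by simp
  finally have eq: "norm (?B (Suc (Suc n)) - ?B (Suc n))
      = norm ((?B (Suc n) + ?B n) o\<^sub>L (?B (Suc n) - ?B n)) / 2"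
    by simp
  have "norm ((?B (Suc n) + ?B n) o\<^sub>L (?B (Suc n) - ?B n))
      \<le> norm (?B (Suc n) + ?B n) * norm (?B (Suc n) - ?B n)"
    by (rule norm_blinfun_compose)
  also have "\<dots> \<le> (?s (Suc n) + ?s n) * (?s (Suc n) - ?s n)"
    by (intro mult_mono Suc norm_triangle_le add_mono norm_sqrt_iter_le assms
        add_nonneg_nonneg norm_ge_zero sqrt_majorant_range[THEN conjunct1])
  also have "\<dots> / 2 = ?s (Suc (Suc n)) - ?s (Suc n)"
    by (simp add: power2_eq_square field_simps)
  finally show ?case
    unfolding eq by simp
qed

lemma norm_sqrt_iter_diff_le:
  assumes "norm A \<le> 1" "m \<le> n"
  shows "norm (sqrt_iter A n - sqrt_iter A m) \<le> sqrt_majorant n - sqrt_majorant m"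
  using \<open>m \<le> n\<close>
proof (induction n rule: dec_induct)
  case (step n)
  have "norm (sqrt_iter A (Suc n) - sqrt_iter A m)
      \<le> norm (sqrt_iter A (Suc n) - sqrt_iter A n) + norm (sqrt_iter A n - sqrt_iter A m)"
    using norm_triangle_ineq[of "sqrt_iter A (Suc n) - sqrt_iter A n" "sqrt_iter A n - sqrt_iter A m"]
    by simp
  with step.IH norm_sqrt_iter_Suc_diff_le[OF assms(1), of n] show ?case
    by linarith
qed simp

lemma Cauchy_sqrt_iter:
  assumes "norm A \<le> 1"
  shows "Cauchy (sqrt_iter A)"
proof (rule CauchyI')
  fix e :: real assume "0 < e"
  then obtain N where N: "\<And>m n. N \<le> m \<Longrightarrow> N \<le> n \<Longrightarrow> norm (sqrt_majorant m - sqrt_majorant n) < e"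
    using CauchyD[OF Cauchy_sqrt_majorant] by metis
  show "\<exists>M. \<forall>m\<ge>M. \<forall>n>m. dist (sqrt_iter A m) (sqrt_iter A n) < e"
  proof (intro exI[of _ N] allI impI)
    fix m n assume "N \<le> m" "m < n"
    then have "norm (sqrt_iter A n - sqrt_iter A m) < e"
      using norm_sqrt_iter_diff_le[OF assms, of m n] N[of n m] by simp
    then show "dist (sqrt_iter A m) (sqrt_iter A n) < e"
      by (simp add: dist_norm norm_minus_commute)
  qed
qed

lemma sqrt_iter_symmetric:
  fixes A :: "'a::real_inner \<Rightarrow>\<^sub>L 'a"
  assumes "\<And>x y. inner (A x) y = inner x (A y)"
  shows "inner (sqrt_iter A n x) y = inner x (sqrt_iter A n y)"
  by (induction n arbitrary: x y)
    (auto simp: blinfun.add_left blinfun.scaleR_left inner_add_left inner_add_right assms)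

text \<open>
  The commutation property passes from \<open>A\<close> to \<open>B\<close> because every iterate is a polynomial in \<open>A\<close>. It
  serves twice: for complex linearity of the root and for its uniqueness.
\<close>

lemma sqrt_iter_limit:
  fixes A :: "'a::{real_inner,banach} \<Rightarrow>\<^sub>L 'a"
  assumes A: "norm A \<le> 1" and sym: "\<And>x y. inner (A x) y = inner x (A y)"
  obtains B :: "'a \<Rightarrow>\<^sub>L 'a" where "norm B \<le> 1" "\<And>x y. inner (B x) y = inner x (B y)"
    "2 *\<^sub>R B = A + (B o\<^sub>L B)" "\<And>C. C o\<^sub>L A = A o\<^sub>L C \<Longrightarrow> C o\<^sub>L B = B o\<^sub>L C"
proof -
  obtain B where B: "sqrt_iter A \<longlonglongrightarrow> B"
    using Cauchy_sqrt_iter[OF A] Cauchy_convergent convergent_def by blast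
  have BSuc: "(\<lambda>n. sqrt_iter A (Suc n)) \<longlonglongrightarrow> B"
    using B by (rule LIMSEQ_Suc)
  show ?thesis
  proof
    show "norm B \<le> 1"
      using norm_sqrt_iter_le[OF A] sqrt_majorant_range order_trans
      by (intro LIMSEQ_le_const2[OF tendsto_norm[OF B]]) blast
    show "inner (B x) y = inner x (B y)" for x y
    proof (rule LIMSEQ_unique)
      show "(\<lambda>n. inner (sqrt_iter A n x) y) \<longlonglongrightarrow> inner (B x) y"
        by (intro tendsto_intros B)
      show "(\<lambda>n. inner (sqrt_iter A n x) y) \<longlonglongrightarrow> inner x (B y)"
        unfolding sqrt_iter_symmetric[OF sym] by (intro tendsto_intros B)
    qed
    have "(\<lambda>n. sqrt_iter A (Suc n)) \<longlonglongrightarrow> (1/2) *\<^sub>R (A + (B o\<^sub>L B))"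
      unfolding sqrt_iter.simps by (intro tendsto_intros B)
    with BSuc have "B = (1/2) *\<^sub>R (A + (B o\<^sub>L B))"
      by (rule LIMSEQ_unique)
    then have "2 *\<^sub>R B = 2 *\<^sub>R (1/2) *\<^sub>R (A + (B o\<^sub>L B))"
      by (rule arg_cong)
    then show "2 *\<^sub>R B = A + (B o\<^sub>L B)"
      by simp
    show "C o\<^sub>L B = B o\<^sub>L C" if "C o\<^sub>L A = A o\<^sub>L C" for C
    proof (rule LIMSEQ_unique)
      show "(\<lambda>n. C o\<^sub>L sqrt_iter A n) \<longlonglongrightarrow> (C o\<^sub>L B)"
        by (intro tendsto_intros B)
      show "(\<lambda>n. C o\<^sub>L sqrt_iter A n) \<longlonglongrightarrow> (B o\<^sub>L C)"
        unfolding sqrt_iter_commute[OF that] by (intro tendsto_intros B)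
    qed
  qed
qed

text \<open>
  The operator \<open>A = 1 - S T / c\<^sup>2\<close>, for \<open>c\<close> a norm bound of \<open>T\<close>, satisfies \<open>norm A \<le> 1\<close> because
  \<open>(norm (S (T x)))\<^sup>2 \<le> c\<^sup>2 (norm (T x))\<^sup>2\<close>; so with \<open>B\<close> from the iteration for \<open>A\<close>, the root of \<open>S T\<close>
  is \<open>c (1 - B)\<close>.
\<close>

lemma real_abs_exists:
  fixes T S :: "'a::{real_inner,banach} \<Rightarrow> 'a"
  assumes T: "bounded_linear T" and S: "bounded_linear S"
    and adj: "\<And>x y. inner (T x) y = inner x (S y)"
  obtains P where "bounded_linear P" "\<And>x y. inner (P x) y = inner x (P y)"
    "\<And>x. 0 \<le> inner (P x) x" "\<And>x. P (P x) = S (T x)"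
    "\<And>C x. bounded_linear C \<Longrightarrow> (\<And>x. C (S (T x)) = S (T (C x))) \<Longrightarrow> C (P x) = P (C x)"
proof -
  interpret T: bounded_linear T by fact
  interpret S: bounded_linear S by fact
  \<comment> \<open>The summand \<open>1\<close> keeps \<open>c\<close> positive when \<open>T\<close> vanishes.\<close>
  define c where "c = onorm T + 1"
  have c: "c > 0"
    using onorm_pos_le[OF T] by (simp add: c_def)
  have Tc: "norm (T x) \<le> c * norm x" for x
    using onorm[OF T, of x] by (simp add: c_def distrib_right add_increasing2)
  have Sc: "norm (S x) \<le> c * norm x" for x
    using norm_adjoint_le[OF adj Tc, of x] c by simp
  have adj': "inner (S x) y = inner x (T y)" for x y
    using adj[of y x] by (simp add: inner_commute)
  define A :: "'a \<Rightarrow>\<^sub>L 'a" where "A = Blinfun (\<lambda>x. x - (1 / c\<^sup>2) *\<^sub>R S (T x))"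
  have A: "A x = x - (1 / c\<^sup>2) *\<^sub>R S (T x)" for x
    unfolding A_def
    by (subst bounded_linear_Blinfun_apply)
      (auto intro!: bounded_linear_sub bounded_linear_ident bounded_linear_scaleR_right
        bounded_linear_compose[OF bounded_linear_scaleR_right] bounded_linear_compose[OF S T])
  have "norm A \<le> 1"
  proof (rule norm_blinfun_bound)
    fix x
    have "(norm (S (T x)))\<^sup>2 \<le> (c * norm (T x))\<^sup>2"
      by (intro power_mono Sc) simp
    then have *: "(norm (S (T x)))\<^sup>2 / c ^ 4 \<le> (norm (T x))\<^sup>2 / c\<^sup>2"
      using c by (simp add: field_simps power_mult_distrib power2_eq_square power4_eq_xxxx)
    have "(norm (A x))\<^sup>2 = (norm x)\<^sup>2 - 2 * ((norm (T x))\<^sup>2 / c\<^sup>2) + (norm (S (T x)))\<^sup>2 / c ^ 4"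
      unfolding A power2_norm_eq_inner
      by (simp add: inner_diff_left inner_diff_right adj[symmetric] adj' inner_commute
          power4_eq_xxxx power2_eq_square)
    also have "\<dots> \<le> (norm x)\<^sup>2 - (norm (T x))\<^sup>2 / c\<^sup>2"
      using * by linarith
    also have "\<dots> \<le> (norm x)\<^sup>2"
      by simp
    finally show "norm (A x) \<le> 1 * norm x"
      using power2_le_imp_le[of "norm (A x)" "norm x"] by simp
  qed simp
  moreover have "inner (A x) y = inner x (A y)" for x y
    by (simp add: A inner_diff_left inner_diff_right adj[symmetric] adj')
  ultimately obtain B :: "'a \<Rightarrow>\<^sub>L 'a" where B: "norm B \<le> 1" "\<And>x y. inner (B x) y = inner x (B y)"
    "2 *\<^sub>R B = A + (B o\<^sub>L B)" "\<And>C. C o\<^sub>L A = A o\<^sub>L C \<Longrightarrow> C o\<^sub>L B = B o\<^sub>L C"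
    using sqrt_iter_limit by blast
  define P where "P x = c *\<^sub>R (x - B x)" for x
  have P_bl: "bounded_linear P"
    unfolding P_def
    by (intro bounded_linear_compose[OF bounded_linear_scaleR_right] bounded_linear_sub
        bounded_linear_ident blinfun.bounded_linear_right)
  show ?thesis
  proof
    show "bounded_linear P" by fact
    show "inner (P x) y = inner x (P y)" for x y
      by (simp add: P_def inner_diff_left inner_diff_right B(2))
    show "0 \<le> inner (P x) x" for x
    proof -
      have "inner (B x) x \<le> norm (B x) * norm x"
        by (rule norm_cauchy_schwarz)
      also have "\<dots> \<le> norm x * norm x"
        using B(1)
        by (intro mult_right_mono order_trans[OF norm_blinfun] mult_left_le_one_le) auto
      finally show ?thesis
        using c by (simp add: P_def inner_diff_left power2_norm_eq_inner[symmetric] power2_eq_square)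
    qed
    show "P (P x) = S (T x)" for x
    proof -
      have BB: "B (B x) = 2 *\<^sub>R B x - A x"
        using arg_cong[OF B(3), of "\<lambda>F. F x"]
        by (simp add: blinfun.add_left blinfun.scaleR_left)
      have "P (P x) = c\<^sup>2 *\<^sub>R (x - 2 *\<^sub>R B x + B (B x))"
        by (simp add: P_def blinfun.scaleR_right blinfun.diff_right power2_eq_square
            scaleR_2 algebra_simps)
      also have "\<dots> = S (T x)"
        using c by (simp add: BB A)
      finally show ?thesis .
    qed
    show "C (P x) = P (C x)"
      if C: "bounded_linear C" and comm: "\<And>x. C (S (T x)) = S (T (C x))" for C x
    proof -
      interpret C: bounded_linear C by fact
      have "Blinfun C o\<^sub>L A = A o\<^sub>L Blinfun C"
        by (rule blinfun_eqI)
          (simp add: A bounded_linear_Blinfun_apply[OF C] C.diff C.scaleR comm)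
      then have "Blinfun C o\<^sub>L B = B o\<^sub>L Blinfun C"
        by (rule B(4))
      from arg_cong[OF this, of "\<lambda>F. F x"] have "C (B x) = B (C x)"
        by (simp add: bounded_linear_Blinfun_apply[OF C])
      then show ?thesis
        by (simp add: P_def C.diff C.scaleR)
    qed
  qed
qed

text \<open>
  A zero \<open>y\<close> of the non-negative form \<open>inner (P x) x\<close> is a minimum, so the derivative of the form at
  \<open>y\<close> vanishes; in the direction \<open>P y\<close> this derivative is twice the square of the norm of \<open>P y\<close>.
\<close>

lemma inner_zero_imp_zero_of_nonneg:
  fixes P :: "'a::real_inner \<Rightarrow> 'a"
  assumes "linear P" and sym: "\<And>x y. inner (P x) y = inner x (P y)"
    and pos: "\<And>x. 0 \<le> inner (P x) x" and "inner (P y) y = 0"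
  shows "P y = 0"
proof -
  interpret linear P by fact
  have "inner (P y) (P y) = 0"
  proof (rule linear_coeff_zero_if_quadratic_nonneg)
    fix t :: real
    have "inner (P (y + t *\<^sub>R P y)) (y + t *\<^sub>R P y)
        = inner (P y) y + 2 * t * inner (P y) (P y) + t\<^sup>2 * inner (P (P y)) (P y)"
      by (simp add: add scale inner_add_left inner_add_right sym[of "P y" y, symmetric]
          inner_commute[of y] power2_eq_square algebra_simps)
    with pos[of "y + t *\<^sub>R P y"] \<open>inner (P y) y = 0\<close>
    show "0 \<le> 2 * t * inner (P y) (P y) + t\<^sup>2 * inner (P (P y)) (P y)"
      by simp
  qed
  then show ?thesis
    by simp
qed

text \<open>
  For \<open>y = P x - Q x\<close> commutation gives \<open>P y + Q y = P (P x) - Q (Q x) = 0\<close>, so both non-negative forms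
  vanish at \<open>y\<close>, whence \<open>P y = Q y = 0\<close> and \<open>y\<close> is orthogonal to itself.
\<close>

lemma nonneg_square_root_unique:
  fixes P Q :: "'a::real_inner \<Rightarrow> 'a"
  assumes "linear P" "\<And>x y. inner (P x) y = inner x (P y)" "\<And>x. 0 \<le> inner (P x) x"
    and "linear Q" "\<And>x y. inner (Q x) y = inner x (Q y)" "\<And>x. 0 \<le> inner (Q x) x"
    and sq: "\<And>x. P (P x) = Q (Q x)" and comm: "\<And>x. P (Q x) = Q (P x)"
  shows "P x = Q x"
proof -
  interpret P: linear P by fact
  interpret Q: linear Q by fact
  define y where "y = P x - Q x"
  have "P y + Q y = 0"
    by (simp add: y_def P.diff Q.diff sq comm)
  then have "inner (P y) y + inner (Q y) y = 0"
    by (simp add: inner_add_left[symmetric])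
  with assms(3,6)[of y] have "inner (P y) y = 0" "inner (Q y) y = 0"
    by linarith+
  then have "P y = 0" "Q y = 0"
    using assms inner_zero_imp_zero_of_nonneg by metis+
  then have "inner y (P x - Q x) = 0"
    using assms(2,5)[of y x] by (simp add: inner_diff_right)
  then show ?thesis
    by (simp add: y_def)
qed

section \<open>Adjoints and absolute values of complex operators\<close>

instance complex_hilbert_space \<subseteq> banach ..

lemma cinner_add_right: "cinner x (y + z) = cinner x y + cinner x z"
  by (metis cinner_add_left cinner_commute complex_cnj_add)

lemma cinner_scaleC_right: "cinner x (a *\<^sub>C y) = cnj a * cinner x y"
  by (metis cinner_commute cinner_scaleC_left complex_cnj_mult)

lemma cinner_scaleR_left: "cinner (r *\<^sub>R x) y = complex_of_real r * cinner x y"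
  by (simp add: scaleR_scaleC cinner_scaleC_left)

lemma cinner_scaleR_right: "cinner x (r *\<^sub>R y) = complex_of_real r * cinner x y"
  by (simp add: scaleR_scaleC cinner_scaleC_right)

lemma cinner_zero_right [simp]: "cinner x 0 = 0"
  using cinner_scaleR_right[of x 0 0] by simp

lemma cinner_diff_left: "cinner (x - y) z = cinner x z - cinner y z"
  using cinner_add_left[of "x - y" y z] by simp

lemma Im_cinner: "Im (cinner x y) = - inner (\<i> *\<^sub>C x) y"
  by (simp add: inner_eq_Re_cinner cinner_scaleC_left)

text \<open>
  The imaginary part of \<open>cinner x y\<close> is a real inner product with the vector \<open>\<i> *\<^sub>C x\<close>, so complex inner
  products can be compared through real ones.
\<close>

lemma cinner_eqI:
  assumes "\<And>c. inner (c *\<^sub>C x) y = inner (c *\<^sub>C u) v"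
  shows "cinner x y = cinner u v"
  using assms[of 1] assms[of \<i>]
  by (intro complex_eqI) (simp_all add: Im_cinner inner_eq_Re_cinner[symmetric])

lemma cinner_eq_zero_commute: "cinner x y = 0 \<longleftrightarrow> cinner y x = 0"
  by (metis cinner_commute complex_cnj_zero)

lemma norm_scaleC: "norm (a *\<^sub>C x) = cmod a * norm x"
proof -
  have "complex_of_real ((norm (a *\<^sub>C x))\<^sup>2) = (a * cnj a) * cinner x x"
    unfolding cinner_self[symmetric] by (simp add: cinner_scaleC_left cinner_scaleC_right)
  also have "\<dots> = complex_of_real ((cmod a * norm x)\<^sup>2)"
    by (simp add: cinner_self complex_norm_square[symmetric] power_mult_distrib)
  finally have "complex_of_real ((norm (a *\<^sub>C x))\<^sup>2) = complex_of_real ((cmod a * norm x)\<^sup>2)" .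
  then have "(norm (a *\<^sub>C x))\<^sup>2 = (cmod a * norm x)\<^sup>2"
    by (simp only: of_real_eq_iff)
  then show ?thesis
    by (rule power2_eq_imp_eq) auto
qed

text \<open>
  Rotating \<open>x\<close> by a scalar \<open>u\<close> of modulus \<open>1\<close> makes \<open>cinner x y\<close> real and non-negative, which reduces
  this to the real Cauchy-Schwarz inequality.
\<close>

lemma cmod_cinner_le: "cmod (cinner x y) \<le> norm x * norm y"
proof (cases "cinner x y = 0")
  case False
  define u where "u = cnj (cinner x y) / cmod (cinner x y)"
  have "cmod u = 1"
    using False by (simp add: u_def norm_divide)
  have "cinner (u *\<^sub>C x) y = cmod (cinner x y)"
    using False by (simp add: u_def cinner_scaleC_left complex_norm_square[symmetric]
        mult.commute[of "cnj _"] power2_eq_square)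
  then have "cmod (cinner x y) = inner (u *\<^sub>C x) y"
    by (simp add: inner_eq_Re_cinner)
  also have "\<dots> \<le> norm (u *\<^sub>C x) * norm y"
    by (rule norm_cauchy_schwarz)
  finally show ?thesis
    using \<open>cmod u = 1\<close> by (simp add: norm_scaleC)
qed simp

lemma bounded_linear_scaleC: "bounded_linear ((*\<^sub>C) c)"
proof (rule bounded_linear_intro)
  show "c *\<^sub>C (r *\<^sub>R x) = r *\<^sub>R (c *\<^sub>C x)" for r x
    by (simp add: scaleR_scaleC scaleC_scaleC mult.commute)
  show "norm (c *\<^sub>C x) \<le> norm x * cmod c" for x
    by (simp add: norm_scaleC)
qed (rule scaleC_add_right)

lemma bounded_linear_scaleC_left: "bounded_linear (\<lambda>c. c *\<^sub>C x)"
proof (rule bounded_linear_intro)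
  show "(r *\<^sub>R c) *\<^sub>C x = r *\<^sub>R (c *\<^sub>C x)" for r c
    by (simp add: scaleR_scaleC scaleC_scaleC scaleR_conv_of_real)
  show "norm (c *\<^sub>C x) \<le> norm c * norm x" for c
    by (simp add: norm_scaleC)
qed (rule scaleC_add_left)

lemma bounded_linear_cinner_right: "bounded_linear (cinner x)"
  by (rule bounded_linear_intro[where K = "norm x"])
    (simp_all add: cinner_add_right cinner_scaleR_right scaleR_conv_of_real cmod_cinner_le
      mult.commute[of "norm _" "norm x"])

lemma bounded_linear_cinner_left: "bounded_linear (\<lambda>x. cinner x y)"
  by (rule bounded_linear_intro[where K = "norm y"])
    (simp_all add: cinner_add_left cinner_scaleR_left scaleR_conv_of_real cmod_cinner_le)

lemma cinner_sum_left: "cinner (sum f A) y = (\<Sum>a\<in>A. cinner (f a) y)"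
  using linear_sum[OF bounded_linear.linear[OF bounded_linear_cinner_left]] .

lemma bounded_operatorsD:
  assumes "T \<in> bounded_operators"
  shows "bounded_linear T" "T (c *\<^sub>C x) = c *\<^sub>C T x"
  using assms by (auto simp: bounded_operators_def bounded_clinear_def)

lemma adjoint_op_spec:
  fixes T :: "'a::complex_hilbert_space \<Rightarrow> 'a"
  assumes "T \<in> bounded_operators"
  shows "adjoint_op T \<in> bounded_operators" "cinner (T x) y = cinner x (adjoint_op T y)"
proof -
  obtain S where S: "bounded_linear S" "\<And>x y. inner (T x) y = inner x (S y)"
    using real_adjoint_exists[OF bounded_operatorsD(1)[OF assms]] by blast
  have cS: "cinner (T x) y = cinner x (S y)" for x y
    by (rule cinner_eqI) (simp flip: S(2) add: bounded_operatorsD(2)[OF assms])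
  have "S (c *\<^sub>C y) = c *\<^sub>C S y" for c y
  proof -
    have "inner x (S (c *\<^sub>C y)) = inner x (c *\<^sub>C S y)" for x
      by (simp add: inner_eq_Re_cinner cS[symmetric] cinner_scaleC_right)
    then show ?thesis
      using vector_eq_ldot by blast
  qed
  with S(1) cS have spec: "S \<in> bounded_operators \<and> (\<forall>x y. cinner (T x) y = cinner x (S y))"
    by (simp add: bounded_operators_def bounded_clinear_def)
  have "adjoint_op T = S"
    unfolding adjoint_op_def
  proof (rule the_equality)
    show "S \<in> bounded_operators \<and> (\<forall>x y. cinner (T x) y = cinner x (S y))"
      by (rule spec)
    show "R = S" if R: "R \<in> bounded_operators \<and> (\<forall>x y. cinner (T x) y = cinner x (R y))" for R
    proof
      fix y
      have "inner x (R y) = inner x (S y)" for x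
        using R spec by (metis inner_eq_Re_cinner)
      then show "R y = S y"
        using vector_eq_ldot by blast
    qed
  qed
  with spec show "adjoint_op T \<in> bounded_operators" "cinner (T x) y = cinner x (adjoint_op T y)"
    by auto
qed

text \<open>
  For a complex linear operator, symmetry for the real inner product alone makes the quadratic form
  real-valued: moving the scalar \<open>\<i>\<close> across the inner product changes its sign.
\<close>

lemma positive_operatorsI:
  assumes "P \<in> bounded_operators" "\<And>x y. inner (P x) y = inner x (P y)"
    and "\<And>x. 0 \<le> inner (P x) x"
  shows "P \<in> positive_operators"
proof -
  have "Im (cinner (P x) x) = 0" for x
  proof -
    have "inner (\<i> *\<^sub>C P x) x = inner (\<i> *\<^sub>C x) (P x)"
      using assms(2)[of "\<i> *\<^sub>C x" x] by (simp add: bounded_operatorsD(2)[OF assms(1)])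
    also have "\<dots> = - inner x (\<i> *\<^sub>C P x)"
      by (simp add: inner_eq_Re_cinner cinner_scaleC_left cinner_scaleC_right)
    finally show ?thesis
      by (simp add: Im_cinner inner_commute)
  qed
  with assms(1,3) show ?thesis
    by (auto simp: positive_operators_def complex_is_Real_iff inner_eq_Re_cinner)
qed

text \<open>
  Self-adjointness follows from the quadratic form being real by polarisation, applied to \<open>x + y\<close> and
  to \<open>x + \<i> *\<^sub>C y\<close>.
\<close>

lemma positive_operatorsD:
  assumes "P \<in> positive_operators"
  shows "P \<in> bounded_operators" "0 \<le> inner (P x) x" "cinner (P x) y = cinner x (P y)"
proof -
  show bd: "P \<in> bounded_operators" and "0 \<le> inner (P x) x"
    using assms by (auto simp: positive_operators_def inner_eq_Re_cinner)
  interpret P: bounded_linear P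
    by (rule bounded_operatorsD(1)[OF bd])
  have real: "Im (cinner (P z) z) = 0" for z
    using assms by (auto simp: positive_operators_def complex_is_Real_iff)
  have Im: "Im (cinner (P u) v) + Im (cinner (P v) u) = 0" for u v
    using real[of "u + v"] real[of u] real[of v]
    by (simp add: P.add cinner_add_left cinner_add_right)
  have Re: "Re (cinner (P u) v) = Re (cinner (P v) u)" for u v
    using Im[of u "\<i> *\<^sub>C v"]
    by (simp add: bounded_operatorsD(2)[OF bd] cinner_scaleC_left cinner_scaleC_right)
  show "cinner (P x) y = cinner x (P y)"
    using Im[of x y] Re[of x y] cinner_commute[of x "P y"]
    by (intro complex_eqI) auto
qed

lemma positive_operators_inner:
  assumes "P \<in> positive_operators"
  shows "inner (P x) y = inner x (P y)"
  by (simp add: inner_eq_Re_cinner positive_operatorsD(3)[OF assms])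

text \<open>
  The real square root commutes with multiplication by each complex scalar, hence is complex linear.
  Any other positive root \<open>Q\<close> commutes with its own square, hence with the constructed root, so
  uniqueness of commuting roots applies.
\<close>

lemma abs_op_spec:
  fixes T :: "'a::complex_hilbert_space \<Rightarrow> 'a"
  assumes T: "T \<in> bounded_operators"
  shows "abs_op T \<in> positive_operators" "abs_op T (abs_op T x) = adjoint_op T (T x)"
proof -
  let ?S = "adjoint_op T"
  note S = adjoint_op_spec[OF T]
  have adj: "inner (T x) y = inner x (?S y)" for x y
    by (simp add: inner_eq_Re_cinner S(2))
  obtain P :: "'a \<Rightarrow> 'a" where P: "bounded_linear P" "\<And>x y. inner (P x) y = inner x (P y)"
    "\<And>x. 0 \<le> inner (P x) x" "\<And>x. P (P x) = ?S (T x)"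
    "\<And>C x. bounded_linear C \<Longrightarrow> (\<And>x. C (?S (T x)) = ?S (T (C x))) \<Longrightarrow> C (P x) = P (C x)"
    by (rule real_abs_exists[OF bounded_operatorsD(1)[OF T] bounded_operatorsD(1)[OF S(1)] adj])
      blast+
  have "P (c *\<^sub>C x) = c *\<^sub>C P x" for c x
    using P(5)[of "(*\<^sub>C) c" x]
    by (simp add: bounded_linear_scaleC bounded_operatorsD(2)[OF T] bounded_operatorsD(2)[OF S(1)])
  with P(1) have "P \<in> bounded_operators"
    by (simp add: bounded_operators_def bounded_clinear_def)
  then have Ppos: "P \<in> positive_operators"
    using P(2,3) by (rule positive_operatorsI)
  have "abs_op T = P"
    unfolding abs_op_def sqrt_op_def
  proof (rule the_equality)
    show "P \<in> positive_operators \<and> P \<circ> P = ?S \<circ> T"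
      using Ppos P(4) by auto
    show "Q = P" if Q: "Q \<in> positive_operators \<and> Q \<circ> Q = ?S \<circ> T" for Q
    proof
      fix x
      have Qpos: "Q \<in> positive_operators" and QQ: "\<And>x. Q (Q x) = ?S (T x)"
        using Q by (auto simp: fun_eq_iff)
      have Qbl: "bounded_linear Q"
        using bounded_operatorsD(1)[OF positive_operatorsD(1)[OF Qpos]] .
      have comm: "Q (P x) = P (Q x)" for x
        using P(5)[OF Qbl, of x] by (simp flip: QQ)
      show "Q x = P x"
        by (rule nonneg_square_root_unique[OF bounded_linear.linear[OF Qbl]
              positive_operators_inner[OF Qpos] positive_operatorsD(2)[OF Qpos]
              bounded_linear.linear[OF P(1)] P(2) P(3)])
          (simp_all add: QQ P(4) comm)
    qed
  qed
  with Ppos P(4) show "abs_op T \<in> positive_operators" "abs_op T (abs_op T x) = ?S (T x)"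
    by auto
qed

lemma inner_abs_op:
  assumes "T \<in> bounded_operators"
  shows "inner (abs_op T x) (abs_op T y) = inner (T x) (T y)"
proof -
  have "inner (abs_op T x) (abs_op T y) = inner x (abs_op T (abs_op T y))"
    by (rule positive_operators_inner[OF abs_op_spec(1)[OF assms]])
  also have "\<dots> = inner (T x) (T y)"
    by (simp add: abs_op_spec(2)[OF assms] inner_eq_Re_cinner adjoint_op_spec(2)[OF assms])
  finally show ?thesis .
qed

lemma norm_abs_op:
  assumes "T \<in> bounded_operators"
  shows "norm (abs_op T x) = norm (T x)"
  by (simp add: norm_eq_sqrt_inner inner_abs_op[OF assms])

section \<open>Reducing subspaces and norm-maximising vectors\<close>

lemma subspace_scaleR:
  assumes "csubspace M" "x \<in> M"
  shows "r *\<^sub>R x \<in> M"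
  using complex_vector.subspace_scale[OF assms] by (simp add: scaleR_scaleC)

lemma exists_unit_vector:
  assumes "csubspace M" "M \<noteq> {0}"
  shows "\<exists>x\<in>M. norm x = 1"
proof -
  obtain y where "y \<in> M" "y \<noteq> 0"
    using assms complex_vector.subspace_0 by blast
  then show ?thesis
    using subspace_scaleR[OF assms(1), of y "1 / norm y"]
    by (intro bexI[of _ "(1 / norm y) *\<^sub>R y"]) auto
qed

lemma bdd_above_norm_on:
  assumes "P \<in> bounded_operators"
  shows "bdd_above ((\<lambda>y. norm (P y)) ` {y \<in> M. norm y = 1})"
proof (rule bdd_aboveI2)
  show "norm (P x) \<le> onorm P" if "x \<in> {y \<in> M. norm y = 1}" for x
    using onorm[OF bounded_operatorsD(1)[OF assms], of x] that by simp
qed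

lemma norm_le_norm_on:
  assumes "P \<in> bounded_operators" "csubspace M" "y \<in> M"
  shows "norm (P y) \<le> norm_on P M * norm y"
proof (cases "y = 0")
  case True
  then show ?thesis
    using linear_0[OF bounded_linear.linear[OF bounded_operatorsD(1)[OF assms(1)]]] by simp
next
  case False
  interpret P: bounded_linear P
    by (rule bounded_operatorsD(1)[OF assms(1)])
  have "norm (P ((1 / norm y) *\<^sub>R y)) \<le> norm_on P M"
    unfolding norm_on_def
    by (rule cSUP_upper[OF _ bdd_above_norm_on[OF assms(1)]])
      (use False subspace_scaleR[OF assms(2,3)] in auto)
  with False show ?thesis
    by (simp add: P.scaleR field_simps)
qed

lemma norm_on_nonneg:
  assumes "P \<in> bounded_operators" "csubspace M" "M \<noteq> {0}"
  shows "0 \<le> norm_on P M"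
  using exists_unit_vector[OF assms(2,3)] norm_le_norm_on[OF assms(1,2)]
  by (metis mult.right_neutral norm_ge_zero order_trans)

lemma reducing_subspacesD:
  assumes "M \<in> reducing_subspaces P"
  shows "csubspace M" "closed M" "x \<in> M \<Longrightarrow> P x \<in> M"
  using assms by (auto simp: reducing_subspaces_def)

text \<open>
  A unit vector that almost maximises the norm of \<open>P\<close> on a reducing subspace is almost an eigenvector
  of \<open>P \<circ> P\<close>: expand the square and use that \<open>P y\<close> stays in the subspace.
\<close>

lemma square_defect_le:
  assumes P: "P \<in> positive_operators" and M: "M \<in> reducing_subspaces P"
    and y: "y \<in> M" "norm y = 1"
  defines "s \<equiv> norm_on P M"
  shows "(norm (P (P y) - s\<^sup>2 *\<^sub>R y))\<^sup>2 \<le> s\<^sup>2 * (s\<^sup>2 - (norm (P y))\<^sup>2)"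
proof -
  have "norm (P (P y)) \<le> s * norm (P y)"
    unfolding s_def
    by (rule norm_le_norm_on[OF positive_operatorsD(1)[OF P]])
      (use reducing_subspacesD[OF M] y in auto)
  then have "(norm (P (P y)))\<^sup>2 \<le> s\<^sup>2 * (norm (P y))\<^sup>2"
    using power_mono[of "norm (P (P y))" "s * norm (P y)" 2] by (simp add: power_mult_distrib)
  moreover have "inner (P (P y)) y = inner (P y) (P y)" "inner y (P (P y)) = inner (P y) (P y)"
    using positive_operators_inner[OF P, of "P y" y] by (simp_all add: inner_commute)
  then have "(norm (P (P y) - s\<^sup>2 *\<^sub>R y))\<^sup>2
      = (norm (P (P y)))\<^sup>2 - 2 * s\<^sup>2 * (norm (P y))\<^sup>2 + s\<^sup>2 * s\<^sup>2 * (norm y)\<^sup>2"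
    unfolding power2_norm_eq_inner
    by (simp add: inner_diff_left inner_diff_right algebra_simps)
  ultimately show ?thesis
    using y by (simp add: algebra_simps)
qed

text \<open>
  The vector \<open>w = P x - \<mu> *\<^sub>R x\<close> satisfies \<open>P w = - \<mu> *\<^sub>R w\<close>, and a positive operator has no negative
  eigenvalues.
\<close>

lemma eigenvector_of_square:
  assumes P: "P \<in> positive_operators" and eq: "P (P x) = \<mu>\<^sup>2 *\<^sub>R x" and "0 \<le> \<mu>"
  shows "P x = \<mu> *\<^sub>R x"
proof (cases "\<mu> = 0")
  case True
  with eq positive_operators_inner[OF P, of x "P x"] show ?thesis
    by simp
next
  case False
  interpret P: bounded_linear P
    by (rule bounded_operatorsD(1)[OF positive_operatorsD(1)[OF P]])
  define w where "w = P x - \<mu> *\<^sub>R x"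
  have "P w = - \<mu> *\<^sub>R w"
    by (simp add: w_def P.diff P.scaleR eq power2_eq_square algebra_simps)
  then have "0 \<le> - (\<mu> * (norm w)\<^sup>2)"
    using positive_operatorsD(2)[OF P, of w] by (simp add: power2_norm_eq_inner)
  with False \<open>0 \<le> \<mu>\<close> have "w = 0"
    by (simp add: mult_le_0_iff)
  then show ?thesis
    by (simp add: w_def)
qed

lemma maximising_vector_is_eigenvector:
  assumes "P \<in> positive_operators" "M \<in> reducing_subspaces P" "x \<in> M" "norm x = 1"
    and "norm (P x) = norm_on P M"
  shows "P x = norm_on P M *\<^sub>R x"
proof (rule eigenvector_of_square)
  show "P (P x) = (norm_on P M)\<^sup>2 *\<^sub>R x"
    using square_defect_le[OF assms(1-4)] assms(5) by simp
  show "0 \<le> norm_on P M"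
    using norm_ge_zero[of "P x"] assms(5) by simp
qed fact

lemma csubspace_orth_compl: "csubspace (orth_compl X)"
  by (auto simp: complex_vector.subspace_def orth_compl_def cinner_add_right cinner_scaleC_right)

lemma closed_orth_compl: "closed (orth_compl X)"
proof -
  have "orth_compl X = (\<Inter>x\<in>X. {y. cinner x y = 0})"
    by (auto simp: orth_compl_def)
  moreover have "closed {y. cinner x y = 0}" for x :: 'a
    by (intro closed_Collect_eq continuous_intros
        bounded_linear.continuous_on[OF bounded_linear_cinner_right])
  ultimately show ?thesis
    by auto
qed

lemma positive_invariant_orth_compl:
  assumes "P \<in> positive_operators" "P ` X \<subseteq> X"
  shows "P ` orth_compl X \<subseteq> orth_compl X"
  using assms(2) by (auto simp: orth_compl_def positive_operatorsD(3)[OF assms(1), symmetric])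

text \<open>
  A self-adjoint operator passes invariance on to orthogonal complements, so each invariant
  complement \<open>orth_compl X\<close> comes with the second invariance that reducing asks for.
\<close>

lemma invariant_imp_reducing:
  assumes "P \<in> positive_operators" "P ` orth_compl X \<subseteq> orth_compl X"
  shows "orth_compl X \<in> reducing_subspaces P"
  using assms(2) positive_invariant_orth_compl[OF assms]
  by (auto simp: reducing_subspaces_def csubspace_orth_compl closed_orth_compl)

lemma orth_compl_eigenvectors_invariant:
  assumes P: "P \<in> positive_operators" and E: "\<And>e. e \<in> E \<Longrightarrow> \<exists>r. P e = r *\<^sub>R e"
  shows "P ` orth_compl E \<subseteq> orth_compl E"
proof -
  have "cinner e (P y) = 0" if "e \<in> E" "y \<in> orth_compl E" for e y
  proof -
    obtain r where r: "P e = r *\<^sub>R e"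
      using E[OF \<open>e \<in> E\<close>] by blast
    have "cinner e (P y) = cinner (r *\<^sub>R e) y"
      by (simp add: positive_operatorsD(3)[OF P, symmetric] r)
    with that show ?thesis
      by (simp add: cinner_scaleR_left orth_compl_def)
  qed
  then show ?thesis
    by (auto simp: orth_compl_def)
qed

section \<open>Compact operators\<close>

text \<open>
  For a maximising sequence \<open>y\<close> of unit vectors, \<open>P (P (y n)) - s\<^sup>2 *\<^sub>R y n\<close> tends to \<open>0\<close>, where \<open>s\<close> is the
  norm to be attained. Since \<open>P (P (y n))\<close> is a continuous image of \<open>T (y n)\<close>, it converges along a
  subsequence, and for \<open>s \<noteq> 0\<close> so does \<open>y\<close>.
\<close>

lemma compact_operator_abs_op_norm_attaining:
  fixes T :: "'a::complex_hilbert_space \<Rightarrow> 'a"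
  assumes T: "T \<in> compact_operators"
    and M: "M \<in> reducing_subspaces (abs_op T)" "M \<noteq> {0}"
  shows "norm_attaining_on (abs_op T) M"
proof -
  have Tb: "T \<in> bounded_operators" and cpt: "compact (closure (T ` cball 0 1))"
    using T by (auto simp: compact_operators_def)
  define P where "P = abs_op T"
  define s where "s = norm_on P M"
  have P: "P \<in> positive_operators" and M': "M \<in> reducing_subspaces P"
    using abs_op_spec[OF Tb] M by (auto simp: P_def)
  note Pb = positive_operatorsD(1)[OF P]
  interpret P: bounded_linear P
    by (rule bounded_operatorsD(1)[OF Pb])
  interpret S: bounded_linear "adjoint_op T"
    by (rule bounded_operatorsD(1)[OF adjoint_op_spec(1)[OF Tb]])
  note M'' = reducing_subspacesD[OF M']
  obtain u where u: "u \<in> M" "norm u = 1"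
    using exists_unit_vector[OF M''(1) M(2)] by blast
  have P_le: "norm (P y) \<le> s" if "y \<in> M" "norm y = 1" for y
    using norm_le_norm_on[OF Pb M''(1) that(1)] that(2) by (simp add: s_def)
  have "s \<ge> 0"
    using norm_on_nonneg[OF Pb M''(1) M(2)] by (simp add: s_def)
  show ?thesis
  proof (cases "s = 0")
    case True
    with u P_le[OF u] show ?thesis
      unfolding norm_attaining_on_def s_def P_def by (intro bexI[of _ u]) auto
  next
    case False
    have "\<exists>y\<in>M. norm y = 1 \<and> s - inverse (real (Suc n)) < norm (P y)" for n
    proof -
      have "s - inverse (real (Suc n)) < (SUP y\<in>{y \<in> M. norm y = 1}. norm (P y))"
        unfolding s_def norm_on_def by simp
      then show ?thesis
        using u by (subst (asm) less_cSUP_iff) (auto intro: bdd_above_norm_on[OF Pb])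
    qed
    then obtain y where y: "\<And>n. y n \<in> M" "\<And>n. norm (y n) = 1"
      "\<And>n. s - inverse (real (Suc n)) < norm (P (y n))"
      by metis
    have Py: "(\<lambda>n. norm (P (y n))) \<longlonglongrightarrow> s"
    proof (rule tendsto_sandwich)
      show "\<forall>\<^sub>F n in sequentially. s - inverse (real (Suc n)) \<le> norm (P (y n))"
        by (intro always_eventually allI less_imp_le y(3))
      show "\<forall>\<^sub>F n in sequentially. norm (P (y n)) \<le> s"
        using P_le y by auto
      show "(\<lambda>n. s - inverse (real (Suc n))) \<longlonglongrightarrow> s"
        using tendsto_diff[OF tendsto_const LIMSEQ_inverse_real_of_nat, of s] by simp
    qed simp
    have "\<forall>n. T (y n) \<in> closure (T ` cball 0 1)"
      using y(2) by (intro allI subsetD[OF closure_subset] imageI) (simp add: dist_norm)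
    then obtain l r where r: "strict_mono r" "((\<lambda>n. T (y n)) \<circ> r) \<longlonglongrightarrow> l"
      using seq_compactE[OF compact_imp_seq_compact[OF cpt], of "\<lambda>n. T (y n)"] by blast
    have PP: "(\<lambda>n. P (P (y (r n)))) \<longlonglongrightarrow> adjoint_op T l"
      using S.tendsto[OF r(2)] by (simp add: P_def abs_op_spec(2)[OF Tb] o_def)
    have defect: "(\<lambda>n. P (P (y (r n))) - s\<^sup>2 *\<^sub>R y (r n)) \<longlonglongrightarrow> 0"
    proof (rule Lim_null_comparison)
      have "(\<lambda>n. sqrt (s\<^sup>2 * (s\<^sup>2 - (norm (P (y n)))\<^sup>2))) \<longlonglongrightarrow> sqrt (s\<^sup>2 * (s\<^sup>2 - s\<^sup>2))"
        by (intro tendsto_intros Py)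
      then have "(\<lambda>n. sqrt (s\<^sup>2 * (s\<^sup>2 - (norm (P (y n)))\<^sup>2))) \<longlonglongrightarrow> 0"
        by simp
      from LIMSEQ_subseq_LIMSEQ[OF this r(1)]
      show "(\<lambda>n. sqrt (s\<^sup>2 * (s\<^sup>2 - (norm (P (y (r n))))\<^sup>2))) \<longlonglongrightarrow> 0"
        by (simp add: o_def)
      show "\<forall>\<^sub>F n in sequentially. norm (P (P (y (r n))) - s\<^sup>2 *\<^sub>R y (r n))
          \<le> sqrt (s\<^sup>2 * (s\<^sup>2 - (norm (P (y (r n))))\<^sup>2))"
        using square_defect_le[OF P M' y(1,2)] unfolding s_def
        by (intro always_eventually allI real_le_rsqrt)
    qed
    define z where "z = (1 / s\<^sup>2) *\<^sub>R adjoint_op T l"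
    have "(\<lambda>n. (1 / s\<^sup>2) *\<^sub>R (P (P (y (r n))) - (P (P (y (r n))) - s\<^sup>2 *\<^sub>R y (r n)))) \<longlonglongrightarrow>
        (1 / s\<^sup>2) *\<^sub>R (adjoint_op T l - 0)"
      by (intro tendsto_intros PP defect)
    then have z: "(\<lambda>n. y (r n)) \<longlonglongrightarrow> z"
      using False by (simp add: z_def)
    have "z \<in> M"
      using closed_sequentially[OF M''(2) _ z] y(1) by blast
    moreover have "norm z = 1"
      using tendsto_norm[OF z] y(2) by (simp add: LIMSEQ_const_iff)
    moreover have "norm (P z) = s"
    proof (rule LIMSEQ_unique)
      show "(\<lambda>n. norm (P (y (r n)))) \<longlonglongrightarrow> norm (P z)"
        by (intro tendsto_norm P.tendsto z)
      show "(\<lambda>n. norm (P (y (r n)))) \<longlonglongrightarrow> s"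
        using LIMSEQ_subseq_LIMSEQ[OF Py r(1)] by (simp add: o_def)
    qed
    ultimately show ?thesis
      unfolding norm_attaining_on_def s_def P_def by blast
  qed
qed

lemma compact_operators_subset_beta0: "compact_operators \<subseteq> beta0"
proof
  fix T :: "'a \<Rightarrow> 'a" assume T: "T \<in> compact_operators"
  then have Tb: "T \<in> bounded_operators"
    by (simp add: compact_operators_def)
  with compact_operator_abs_op_norm_attaining[OF T] abs_op_spec(1)[OF Tb] show "T \<in> beta0"
    by (auto simp: beta0_def beta_def positive_operators_def)
qed

lemma bounded_operators_add:
  assumes "T \<in> bounded_operators" "K \<in> bounded_operators"
  shows "(\<lambda>x. T x + K x) \<in> bounded_operators"
  using assms by (auto simp: bounded_operators_def bounded_clinear_def scaleC_add_right
      intro: bounded_linear_add)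

lemma compact_closure_subset:
  fixes C :: "'a::metric_space set"
  assumes "compact C" "S \<subseteq> C"
  shows "compact (closure S)"
proof -
  have "closure S \<subseteq> C"
    using assms by (intro closure_minimal compact_imp_closed)
  then have "C \<inter> closure S = closure S"
    by (rule Int_absorb1)
  with compact_Int_closed[OF assms(1) closed_closure, of S] show ?thesis
    by simp
qed

lemma compact_operators_add:
  assumes "T \<in> compact_operators" "K \<in> compact_operators"
  shows "(\<lambda>x. T x + K x) \<in> compact_operators"
proof -
  let ?C = "{x + y |x y. x \<in> closure (T ` cball 0 1) \<and> y \<in> closure (K ` cball 0 1)}"
  have "compact ?C"
    using assms by (intro compact_sums) (auto simp: compact_operators_def)
  moreover have "(\<lambda>x. T x + K x) ` cball 0 1 \<subseteq> ?C"
    using closure_subset[of "T ` cball 0 1"] closure_subset[of "K ` cball 0 1"] by blast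
  ultimately have "compact (closure ((\<lambda>x. T x + K x) ` cball 0 1))"
    by (rule compact_closure_subset)
  with assms show ?thesis
    by (auto simp: compact_operators_def bounded_operators_add)
qed

lemma compact_closure_if_near_compact:
  fixes S :: "'a::complete_space set"
  assumes "\<And>e. e > 0 \<Longrightarrow> \<exists>C. compact C \<and> (\<forall>x\<in>S. \<exists>c\<in>C. dist c x < e)"
  shows "compact (closure S)"
  unfolding compact_eq_totally_bounded
proof (intro conjI allI impI)
  show "complete (closure S)"
    by (simp add: complete_eq_closed)
  fix e :: real assume "e > 0"
  then obtain C where C: "compact C" "\<And>x. x \<in> S \<Longrightarrow> \<exists>c\<in>C. dist c x < e / 4"
    using assms[of "e / 4"] by auto
  obtain k where k: "finite k" "C \<subseteq> (\<Union>x\<in>k. ball x (e / 4))"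
    using C(1) \<open>e > 0\<close> unfolding compact_eq_totally_bounded by (meson divide_pos_pos zero_less_numeral)
  have "S \<subseteq> (\<Union>x\<in>k. cball x (e / 2))"
  proof
    fix x assume "x \<in> S"
    then obtain c where c: "c \<in> C" "dist c x < e / 4"
      using C(2) by blast
    then obtain a where "a \<in> k" "dist a c < e / 4"
      using k(2) by auto
    with c dist_triangle[of a x c] show "x \<in> (\<Union>x\<in>k. cball x (e / 2))"
      by (intro UN_I[of a]) auto
  qed
  then have "closure S \<subseteq> (\<Union>x\<in>k. cball x (e / 2))"
    using k(1) by (intro closure_minimal closed_UN) auto
  also have "\<dots> \<subseteq> (\<Union>x\<in>k. ball x e)"
    using \<open>e > 0\<close> by (intro UN_mono) auto
  finally show "\<exists>k. finite k \<and> closure S \<subseteq> (\<Union>x\<in>k. ball x e)"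
    using k(1) by blast
qed

lemma bounded_combinations_in_compact:
  fixes v :: "nat \<Rightarrow> 'a::complex_hilbert_space"
  shows "\<exists>C. compact C \<and> (\<forall>c. (\<forall>i. cmod (c i) \<le> 1) \<longrightarrow> (\<Sum>i<n. c i *\<^sub>C v i) \<in> C)"
proof (induction n)
  case 0
  show ?case
    by (intro exI[of _ "{0}"]) auto
next
  case (Suc n)
  then obtain C where C: "compact C" "\<And>c. (\<forall>i. cmod (c i) \<le> 1) \<Longrightarrow> (\<Sum>i<n. c i *\<^sub>C v i) \<in> C"
    by blast
  let ?D = "(\<lambda>c. c *\<^sub>C v n) ` cball 0 1"
  have "compact ?D"
    by (intro compact_continuous_image linear_continuous_on bounded_linear_scaleC_left compact_cball)
  with C(1) have "compact {x + y |x y. x \<in> C \<and> y \<in> ?D}"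
    by (rule compact_sums)
  moreover have "(\<Sum>i<Suc n. c i *\<^sub>C v i) \<in> {x + y |x y. x \<in> C \<and> y \<in> ?D}"
    if "\<forall>i. cmod (c i) \<le> 1" for c
    using C(2)[OF that] that
    by (intro CollectI exI[of _ "\<Sum>i<n. c i *\<^sub>C v i"] exI[of _ "c n *\<^sub>C v n"]) auto
  ultimately show ?case
    by blast
qed

text \<open>
  Norm limits of operators of finite rank are compact: the image of the unit ball under the
  approximating operator lies in the compact set of combinations with coefficients in the unit disc.
\<close>

lemma compact_operatorsI_finite_rank:
  fixes T :: "'a::complex_hilbert_space \<Rightarrow> 'a" and u :: "nat \<Rightarrow> 'a"
  assumes T: "T \<in> bounded_operators"
    and u: "\<And>i. norm (u i) \<le> 1"
    and approx: "\<And>e. e > 0 \<Longrightarrow> \<exists>n v. \<forall>x. norm x \<le> 1 \<longrightarrow>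
      norm (T x - (\<Sum>i<n. cinner x (u i) *\<^sub>C v i)) < e"
  shows "T \<in> compact_operators"
proof -
  have "compact (closure (T ` cball 0 1))"
  proof (rule compact_closure_if_near_compact)
    fix e :: real assume "e > 0"
    then obtain n v where v: "\<And>x. norm x \<le> 1 \<Longrightarrow> norm (T x - (\<Sum>i<n. cinner x (u i) *\<^sub>C v i)) < e"
      using approx by metis
    obtain C where C: "compact C" "\<And>c. (\<forall>i. cmod (c i) \<le> 1) \<Longrightarrow> (\<Sum>i<n. c i *\<^sub>C v i) \<in> C"
      using bounded_combinations_in_compact[where n = n and v = v] by blast
    have "(\<Sum>i<n. cinner x (u i) *\<^sub>C v i) \<in> C" if "norm x \<le> 1" for x
    proof (rule C(2), rule allI)
      show "cmod (cinner x (u i)) \<le> 1" for i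
        using cmod_cinner_le[of x "u i"] that u[of i] mult_le_one[of "norm x" "norm (u i)"] by simp
    qed
    then have "\<exists>c\<in>C. dist c (T x) < e" if "norm x \<le> 1" for x
      using v[OF that] that
      by (intro bexI[of _ "\<Sum>i<n. cinner x (u i) *\<^sub>C v i"]) (auto simp: dist_norm norm_minus_commute)
    with C(1) show "\<exists>C. compact C \<and> (\<forall>y\<in>T ` cball 0 1. \<exists>c\<in>C. dist c y < e)"
      by (intro exI[of _ C]) auto
  qed
  with T show ?thesis
    by (simp add: compact_operators_def)
qed

section \<open>Orthonormal sequences of eigenvectors\<close>

definition orthonormal :: "'a::complex_hilbert_space set \<Rightarrow> bool" where
  "orthonormal E \<longleftrightarrow> (\<forall>e\<in>E. \<forall>f\<in>E. cinner e f = (if e = f then 1 else 0))"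

lemma norm_le_norm_add_orthogonal:
  fixes u v :: "'a::real_inner"
  assumes "inner u v = 0"
  shows "norm v \<le> norm (u + v)"
proof (rule power2_le_imp_le)
  show "(norm v)\<^sup>2 \<le> (norm (u + v))\<^sup>2"
    using norm_add_Pythagorean[of u v] assms by (simp add: orthogonal_def)
qed simp

lemma orthonormal_residual:
  assumes "finite E" "orthonormal E"
  shows "x - (\<Sum>e\<in>E. cinner x e *\<^sub>C e) \<in> orth_compl E" (is "?z \<in> _")
    and "norm (x - (\<Sum>e\<in>E. cinner x e *\<^sub>C e)) \<le> norm x"
proof -
  have zf: "cinner ?z f = 0" if "f \<in> E" for f
  proof -
    have "cinner (\<Sum>e\<in>E. cinner x e *\<^sub>C e) f = (\<Sum>e\<in>E. if e = f then cinner x f else 0)"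
      unfolding cinner_sum_left
      using assms(2) that by (intro sum.cong) (auto simp: orthonormal_def cinner_scaleC_left)
    with assms(1) that show ?thesis
      by (simp add: cinner_diff_left)
  qed
  then show "?z \<in> orth_compl E"
    by (simp add: orth_compl_def cinner_eq_zero_commute[of _ ?z])
  have "cinner (\<Sum>e\<in>E. cinner x e *\<^sub>C e) ?z = 0"
    unfolding cinner_sum_left using zf
    by (intro sum.neutral) (simp add: cinner_scaleC_left cinner_eq_zero_commute[of _ ?z])
  then have "inner (\<Sum>e\<in>E. cinner x e *\<^sub>C e) ?z = 0"
    by (simp add: inner_eq_Re_cinner)
  from norm_le_norm_add_orthogonal[OF this] show "norm ?z \<le> norm x"
    by simp
qed

lemma finite_orthonormal_orth_compl_nontrivial:
  fixes E :: "'a::complex_hilbert_space set"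
  assumes "finite E" "orthonormal E" and "\<not> (\<exists>B :: 'a set. finite B \<and> cspan B = UNIV)"
  shows "orth_compl E \<noteq> {0}"
proof
  assume "orth_compl E = {0}"
  then have "x = (\<Sum>e\<in>E. cinner x e *\<^sub>C e)" for x
    using orthonormal_residual(1)[OF assms(1,2), of x] by simp
  moreover have "(\<Sum>e\<in>E. cinner x e *\<^sub>C e) \<in> cspan E" for x
    by (intro complex_vector.span_sum complex_vector.span_scale complex_vector.span_base)
  ultimately have "cspan E = UNIV"
    by (metis UNIV_eq_I)
  with assms(1,3) show False
    by blast
qed

text \<open>
  The complement of finitely many orthonormal eigenvectors is a reducing subspace, non-trivial as the
  space has infinite dimension, so \<open>P\<close> attains its norm there.
\<close>

lemma next_eigenvector:
  fixes P :: "'a::complex_hilbert_space \<Rightarrow> 'a"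
  assumes P: "P \<in> positive_operators" "P \<in> beta"
    and inf: "\<not> (\<exists>B :: 'a set. finite B \<and> cspan B = UNIV)"
    and E: "finite E" "orthonormal E" "\<And>e. e \<in> E \<Longrightarrow> \<exists>r. P e = r *\<^sub>R e"
  shows "\<exists>x\<in>orth_compl E. norm x = 1 \<and> P x = norm (P x) *\<^sub>R x \<and>
    (\<forall>y\<in>orth_compl E. norm (P y) \<le> norm (P x) * norm y)"
proof -
  let ?M = "orth_compl E"
  have red: "?M \<in> reducing_subspaces P"
    by (intro invariant_imp_reducing orth_compl_eigenvectors_invariant P E)
  moreover have "?M \<noteq> {0}"
    by (intro finite_orthonormal_orth_compl_nontrivial E inf)
  ultimately obtain x where x: "x \<in> ?M" "norm x = 1" "norm (P x) = norm_on P ?M"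
    using P(2) by (auto simp: beta_def norm_attaining_on_def)
  show ?thesis
    using x maximising_vector_is_eigenvector[OF P(1) red x]
      norm_le_norm_on[OF positive_operatorsD(1)[OF P(1)] csubspace_orth_compl]
    by (intro bexI[of _ x]) simp_all
qed

text \<open>
  The greedy choice: each new vector maximises the norm of \<open>P\<close> on the complement of the earlier ones.
  So the eigenvalue at stage \<open>n\<close> bounds \<open>P\<close> on that whole complement, which yields both that the
  eigenvalues decrease and that \<open>P\<close> is small off a finite span once they are small.
\<close>

lemma eigenvector_sequence:
  fixes P :: "'a::complex_hilbert_space \<Rightarrow> 'a"
  assumes P: "P \<in> positive_operators" "P \<in> beta"
    and inf: "\<not> (\<exists>B :: 'a set. finite B \<and> cspan B = UNIV)"
  obtains e :: "nat \<Rightarrow> 'a" where "\<And>i j. cinner (e i) (e j) = (if i = j then 1 else 0)"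
    "\<And>n. P (e n) = norm (P (e n)) *\<^sub>R e n"
    "\<And>n y. y \<in> orth_compl (e ` {..<n}) \<Longrightarrow> norm (P y) \<le> norm (P (e n)) * norm y"
proof -
  define good where "good E \<longleftrightarrow> finite E \<and> orthonormal E \<and> (\<forall>e\<in>E. \<exists>r. P e = r *\<^sub>R e)" for E
  define succeeds where "succeeds E x \<longleftrightarrow> x \<in> orth_compl E \<and> norm x = 1 \<and>
    P x = norm (P x) *\<^sub>R x \<and> (\<forall>y\<in>orth_compl E. norm (P y) \<le> norm (P x) * norm y)" for E x
  have "\<exists>x. succeeds E x" if "good E" for E
    using next_eigenvector[OF P inf, of E] that by (auto simp: good_def succeeds_def)
  then obtain g where g: "\<And>E. good E \<Longrightarrow> succeeds E (g E)"
    by metis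
  \<comment> \<open>\<open>F n\<close> collects the vectors chosen before stage \<open>n\<close>.\<close>
  define F where "F = rec_nat {} (\<lambda>n E. insert (g E) E)"
  define e where "e n = g (F n)" for n
  have F_eq: "F n = e ` {..<n}" for n
    by (induction n) (auto simp: F_def e_def lessThan_Suc)
  have good_insert: "good (insert x E)" if "good E" "succeeds E x" for x E
  proof -
    have "cinner x x = 1" "\<And>f. f \<in> E \<Longrightarrow> cinner f x = 0 \<and> cinner x f = 0"
      using that(2) by (auto simp: succeeds_def orth_compl_def cinner_self cinner_eq_zero_commute)
    with that(1) have "orthonormal (insert x E)"
      unfolding good_def orthonormal_def by (metis insert_iff)
    moreover have "\<exists>r. P x = r *\<^sub>R x"
      using that(2) unfolding succeeds_def by blast
    ultimately show ?thesis
      using that(1) by (auto simp: good_def)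
  qed
  have "good (F n)" for n
  proof (induction n)
    case 0
    show ?case
      by (simp add: F_def good_def orthonormal_def)
  next
    case (Suc n)
    then show ?case
      using good_insert g by (simp add: F_def)
  qed
  then have "succeeds (F n) (e n)" for n
    unfolding e_def by (rule g)
  then have succ: "succeeds (e ` {..<n}) (e n)" for n
    by (simp add: F_eq)
  have less: "cinner (e i) (e j) = 0" if "i < j" for i j
    using succ[of j] that by (auto simp: succeeds_def orth_compl_def)
  have "cinner (e i) (e i) = 1" for i
    using succ[of i] by (simp add: succeeds_def cinner_self)
  then have "cinner (e i) (e j) = (if i = j then 1 else 0)" for i j
    using less[of i j] less[of j i] cinner_eq_zero_commute[of "e i" "e j"] by (cases i j rule: linorder_cases) auto
  with succ show ?thesis
    unfolding succeeds_def by (intro that[of e]) blast+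
qed

lemma bounded_operators_comp:
  assumes "T \<in> bounded_operators" "D \<in> bounded_operators"
  shows "(\<lambda>x. T (D x)) \<in> bounded_operators"
  using assms by (auto simp: bounded_operators_def bounded_clinear_def intro: bounded_linear_compose)

lemma compact_operators_comp:
  assumes T: "T \<in> bounded_operators" and D: "D \<in> compact_operators"
  shows "(\<lambda>x. T (D x)) \<in> compact_operators"
proof -
  have "compact (closure ((\<lambda>x. T (D x)) ` cball 0 1))"
  proof (rule compact_closure_subset)
    show "compact (T ` closure (D ` cball 0 1))"
      using D by (intro compact_continuous_image linear_continuous_on bounded_operatorsD(1)[OF T])
        (auto simp: compact_operators_def)
    show "(\<lambda>x. T (D x)) ` cball 0 1 \<subseteq> T ` closure (D ` cball 0 1)"
      using closure_subset[of "D ` cball 0 1"] by blast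
  qed
  with assms show ?thesis
    by (simp add: compact_operators_def bounded_operators_comp)
qed

lemma orthonormal_seqD:
  fixes f :: "nat \<Rightarrow> 'a::complex_hilbert_space"
  assumes "\<And>i j. cinner (f i) (f j) = (if i = j then 1 else 0)"
  shows "norm (f n) = 1" "inj f" "orthonormal (f ` A)"
proof -
  show "norm (f n) = 1"
    by (simp add: norm_eq_1 inner_eq_Re_cinner assms)
  show inj: "inj f"
    using assms by (metis injI zero_neq_one)
  then show "orthonormal (f ` A)"
    using assms by (auto simp: orthonormal_def inj_eq)
qed

text \<open>
  Subtracting from \<open>x\<close> its projection to the first \<open>n\<close> vectors leaves an element of their complement,
  on which \<open>T\<close> is bounded by \<open>l n\<close>; so \<open>T\<close> is approximated by its restrictions to finite spans.
\<close>

lemma compact_if_eigenvalues_tendsto_zero: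
  fixes T :: "'a::complex_hilbert_space \<Rightarrow> 'a"
  assumes T: "T \<in> bounded_operators"
    and e: "\<And>i j. cinner (e i) (e j) = (if i = j then 1 else 0)"
    and bound: "\<And>n y. y \<in> orth_compl (e ` {..<n}) \<Longrightarrow> norm (T y) \<le> l n * norm y"
    and l: "l \<longlonglongrightarrow> 0" "\<And>n. 0 \<le> l n"
  shows "T \<in> compact_operators"
proof (rule compact_operatorsI_finite_rank[OF T, of e])
  interpret T: bounded_linear T
    by (rule bounded_operatorsD(1)[OF T])
  show "norm (e i) \<le> 1" for i
    using orthonormal_seqD(1)[OF e] by simp
  fix \<epsilon> :: real assume "\<epsilon> > 0"
  then obtain n where n: "l n < \<epsilon>"
    using eventually_happens'[OF sequentially_bot order_tendstoD(2)[OF l(1)]] by blast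
  have "norm (T x - (\<Sum>i<n. cinner x (e i) *\<^sub>C T (e i))) < \<epsilon>" if "norm x \<le> 1" for x
  proof -
    define z where "z = x - (\<Sum>u\<in>e ` {..<n}. cinner x u *\<^sub>C u)"
    have z: "z \<in> orth_compl (e ` {..<n})" "norm z \<le> norm x"
      unfolding z_def by (intro orthonormal_residual orthonormal_seqD(3)[OF e] finite_imageI finite_lessThan)+
    have "z = x - (\<Sum>i<n. cinner x (e i) *\<^sub>C e i)"
      unfolding z_def
      by (subst sum.reindex) (use orthonormal_seqD(2)[OF e] in \<open>auto intro: inj_on_subset\<close>)
    then have "norm (T x - (\<Sum>i<n. cinner x (e i) *\<^sub>C T (e i))) = norm (T z)"
      by (simp add: T.diff T.sum bounded_operatorsD(2)[OF T])
    also have "\<dots> \<le> l n * norm z"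
      by (rule bound[OF z(1)])
    also have "\<dots> \<le> l n * 1"
      using z(2) that l(2) by (intro mult_left_mono) auto
    finally show ?thesis
      using n by simp
  qed
  then show "\<exists>n v. \<forall>x. norm x \<le> 1 \<longrightarrow> norm (T x - (\<Sum>i<n. cinner x (e i) *\<^sub>C v i)) < \<epsilon>"
    by (intro exI[of _ n] exI[of _ "\<lambda>i. T (e i)"]) blast
qed

section \<open>Destroying norm attainment by a compact perturbation\<close>

text \<open>
  Summability of the diagonal entries makes the defining series converge absolutely in operator norm,
  so compactness follows from the finite partial sums.
\<close>

lemma diagonal_operator:
  fixes f :: "nat \<Rightarrow> 'a::complex_hilbert_space" and d :: "nat \<Rightarrow> real"
  assumes f: "\<And>i j. cinner (f i) (f j) = (if i = j then 1 else 0)"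
    and d: "summable (\<lambda>n. \<bar>d n\<bar>)"
  obtains D where "D \<in> compact_operators" "\<And>n. D (f n) = d n *\<^sub>R f n"
    "\<And>n x. inner (f n) (D x) = d n * inner (f n) x"
proof -
  define t where "t x n = (d n * cinner x (f n)) *\<^sub>C f n" for x n
  define D where "D x = (\<Sum>n. t x n)" for x
  note nf = orthonormal_seqD(1)[OF f]
  have t_le: "norm (t x n) \<le> \<bar>d n\<bar> * norm x" for x n
    using cmod_cinner_le[of x "f n"]
    by (simp add: t_def norm_scaleC norm_mult nf mult_left_mono)
  have sum_norm: "summable (\<lambda>n. norm (t x n))" for x
    by (rule summable_comparison_test'[OF summable_mult2[OF d, of "norm x"]]) (simp add: t_le)
  then have sum_t: "summable (t x)" for x
    by (rule summable_norm_cancel)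
  have tail: "norm (D x - (\<Sum>i<n. t x i)) \<le> (\<Sum>i. \<bar>d (i + n)\<bar>) * norm x" for x n
  proof -
    have s: "summable (\<lambda>i. \<bar>d (i + n)\<bar>)"
      by (rule summable_ignore_initial_segment[OF d])
    have sn: "summable (\<lambda>i. norm (t x (i + n)))"
      by (rule summable_ignore_initial_segment[OF sum_norm])
    have "D x - (\<Sum>i<n. t x i) = (\<Sum>i. t x (i + n))"
      unfolding D_def using suminf_split_initial_segment[OF sum_t, of x n] by simp
    also have "norm \<dots> \<le> (\<Sum>i. norm (t x (i + n)))"
      by (rule summable_norm[OF sn])
    also have "\<dots> \<le> (\<Sum>i. \<bar>d (i + n)\<bar> * norm x)"
      by (intro suminf_le t_le sn summable_mult2 s)
    also have "\<dots> = (\<Sum>i. \<bar>d (i + n)\<bar>) * norm x"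
      by (rule suminf_mult2[OF s, symmetric])
    finally show ?thesis .
  qed
  have "bounded_linear D"
  proof (rule bounded_linear_intro)
    show "D (x + y) = D x + D y" for x y
    proof -
      have "t (x + y) = (\<lambda>n. t x n + t y n)"
        by (rule ext) (simp add: t_def cinner_add_left distrib_left scaleC_add_left)
      then show ?thesis
        unfolding D_def by (simp add: suminf_add[OF sum_t sum_t])
    qed
    show "D (r *\<^sub>R x) = r *\<^sub>R D x" for r x
    proof -
      have "t (r *\<^sub>R x) = (\<lambda>n. r *\<^sub>R t x n)"
        by (rule ext) (simp add: t_def cinner_scaleC_left scaleR_scaleC scaleC_scaleC mult_ac)
      then show ?thesis
        unfolding D_def by (simp add: suminf_scaleR_right[OF sum_t])
    qed
    show "norm (D x) \<le> norm x * (\<Sum>i. \<bar>d i\<bar>)" for x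
      using tail[of x 0] by (simp add: mult.commute)
  qed
  moreover have "D (c *\<^sub>C x) = c *\<^sub>C D x" for c x
  proof -
    have "t (c *\<^sub>C x) = (\<lambda>n. c *\<^sub>C t x n)"
      by (rule ext) (simp add: t_def cinner_scaleC_left scaleC_scaleC mult_ac)
    then show ?thesis
      unfolding D_def using bounded_linear.suminf[OF bounded_linear_scaleC sum_t, of c x] by simp
  qed
  ultimately have D: "D \<in> bounded_operators"
    by (simp add: bounded_operators_def bounded_clinear_def)
  show ?thesis
  proof
    show "D \<in> compact_operators"
    proof (rule compact_operatorsI_finite_rank[OF D, of f])
      fix \<epsilon> :: real assume "\<epsilon> > 0"
      then have "\<forall>\<^sub>F n in sequentially. (\<Sum>i. \<bar>d (i + n)\<bar>) < \<epsilon>"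
        using suminf_exist_split2[OF d] by (rule order_tendstoD(2)[rotated])
      then obtain n where n: "(\<Sum>i. \<bar>d (i + n)\<bar>) < \<epsilon>"
        using eventually_happens'[OF sequentially_bot] by blast
      have "norm (D x - (\<Sum>i<n. t x i)) < \<epsilon>" if "norm x \<le> 1" for x
      proof -
        have "(\<Sum>i. \<bar>d (i + n)\<bar>) * norm x \<le> (\<Sum>i. \<bar>d (i + n)\<bar>) * 1"
          using that d by (intro mult_left_mono suminf_nonneg) (auto intro: summable_ignore_initial_segment)
        with tail[of x n] n show ?thesis
          by simp
      qed
      then show "\<exists>n v. \<forall>x. norm x \<le> 1 \<longrightarrow> norm (D x - (\<Sum>i<n. cinner x (f i) *\<^sub>C v i)) < \<epsilon>"
        by (intro exI[of _ n] exI[of _ "\<lambda>i. d i *\<^sub>R f i"])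
          (simp add: t_def scaleR_scaleC scaleC_scaleC mult.commute)
    qed (simp add: nf)
    show "D (f n) = d n *\<^sub>R f n" for n
    proof -
      have "D (f n) = (\<Sum>m\<in>{n}. t (f n) m)"
        unfolding D_def by (rule suminf_finite) (auto simp: t_def f)
      then show ?thesis
        by (simp add: t_def f scaleR_scaleC)
    qed
    show "inner (f n) (D x) = d n * inner (f n) x" for n x
    proof -
      have "cinner (D x) (f n) = (\<Sum>m. cinner (t x m) (f n))"
        unfolding D_def by (rule bounded_linear.suminf[OF bounded_linear_cinner_left sum_t])
      also have "\<dots> = (\<Sum>m\<in>{n}. cinner (t x m) (f n))"
        by (rule suminf_finite) (auto simp: t_def f cinner_scaleC_left)
      also have "\<dots> = d n * cinner x (f n)"
        by (simp add: t_def f cinner_scaleC_left)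
      finally have "inner (D x) (f n) = d n * inner x (f n)"
        by (simp add: inner_eq_Re_cinner)
      then show ?thesis
        by (simp add: inner_commute)
    qed
  qed
qed

text \<open>
  The perturbed operator is \<open>W = T \<circ> (1 + D)\<close> with \<open>D\<close> diagonal with entries \<open>d n\<close>; its absolute value
  \<open>Q\<close> has the eigenvectors \<open>f n\<close> with eigenvalues \<open>\<mu> n = (1 + d n) * l n\<close>. On the closed span \<open>M\<close> of
  the \<open>f n\<close>, written as a double complement, a vector attaining the norm of \<open>Q\<close> would be an
  eigenvector for an eigenvalue \<open>s \<ge> \<alpha>\<close>. As every \<open>\<mu> n\<close> is smaller than \<open>\<alpha>\<close>, that vector would be
  orthogonal to all \<open>f n\<close>, hence to \<open>M\<close>.
\<close>

lemma compact_perturbation_not_beta0: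
  fixes T :: "'a::complex_hilbert_space \<Rightarrow> 'a"
  assumes T: "T \<in> bounded_operators"
    and f: "\<And>i j. cinner (f i) (f j) = (if i = j then 1 else 0)"
    and eig: "\<And>n. abs_op T (f n) = l n *\<^sub>R f n"
    and d: "summable (\<lambda>n. \<bar>d n\<bar>)"
    and \<mu>: "\<And>n. 0 \<le> (1 + d n) * l n" "\<And>n. (1 + d n) * l n < \<alpha>"
    and lim: "(\<lambda>n. (1 + d n) * l n) \<longlonglongrightarrow> \<alpha>"
  shows "\<exists>K\<in>compact_operators. (\<lambda>x. T x + K x) \<notin> beta0"
proof -
  obtain D where D: "D \<in> compact_operators" "\<And>n. D (f n) = d n *\<^sub>R f n"
    "\<And>n x. inner (f n) (D x) = d n * inner (f n) x"
    using diagonal_operator[OF f d] by blast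
  interpret T: bounded_linear T
    by (rule bounded_operatorsD(1)[OF T])
  note nf = orthonormal_seqD(1)[OF f]
  define \<mu> where "\<mu> n = (1 + d n) * l n" for n
  define K where "K x = T (D x)" for x
  have K: "K \<in> compact_operators"
    using compact_operators_comp[OF T D(1)] by (simp add: K_def[abs_def])
  define W where "W x = T x + K x" for x
  have W: "W \<in> bounded_operators"
    unfolding W_def using K by (intro bounded_operators_add T) (simp add: compact_operators_def)
  define Q where "Q = abs_op W"
  have Q: "Q \<in> positive_operators"
    unfolding Q_def by (rule abs_op_spec(1)[OF W])
  have P: "abs_op T \<in> positive_operators"
    by (rule abs_op_spec(1)[OF T])
  interpret P: bounded_linear "abs_op T"
    by (rule bounded_operatorsD(1)[OF positive_operatorsD(1)[OF P]])
  have Tf: "inner (T (f n)) (T z) = (l n)\<^sup>2 * inner (f n) z" for n z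
  proof -
    have "inner (T (f n)) (T z) = inner (abs_op T (f n)) (abs_op T z)"
      by (rule inner_abs_op[OF T, symmetric])
    also have "\<dots> = inner (abs_op T (abs_op T (f n))) z"
      by (rule positive_operators_inner[OF P, symmetric])
    finally show ?thesis
      by (simp add: eig P.scaleR power2_eq_square)
  qed
  have "Q (Q (f n)) = (\<mu> n)\<^sup>2 *\<^sub>R f n" for n
  proof -
    have "inner (Q (Q (f n))) y = inner ((\<mu> n)\<^sup>2 *\<^sub>R f n) y" for y
    proof -
      have "inner (Q (Q (f n))) y = inner (W (f n)) (W y)"
        unfolding Q_def inner_abs_op[OF W, symmetric]
        by (rule positive_operators_inner) (use Q Q_def in simp)
      also have "W (f n) = (1 + d n) *\<^sub>R T (f n)"
        by (simp add: W_def K_def D(2) T.scaleR scaleR_left_distrib)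
      also have "W y = T (y + D y)"
        by (simp add: W_def K_def T.add)
      finally show ?thesis
        by (simp add: Tf inner_add_right D(3) \<mu>_def power2_eq_square algebra_simps)
    qed
    then show ?thesis
      using vector_eq_rdot by blast
  qed
  then have Qf: "Q (f n) = \<mu> n *\<^sub>R f n" for n
    using \<mu>(1) by (intro eigenvector_of_square[OF Q]) (simp_all add: \<mu>_def)
  define N where "N = orth_compl (range f)"
  define M where "M = orth_compl N"
  have "Q ` N \<subseteq> N"
    unfolding N_def using Qf by (intro orth_compl_eigenvectors_invariant[OF Q]) blast
  then have "Q ` M \<subseteq> M"
    unfolding M_def by (rule positive_invariant_orth_compl[OF Q])
  then have M: "M \<in> reducing_subspaces Q"
    unfolding M_def by (rule invariant_imp_reducing[OF Q])
  have fM: "f n \<in> M" for n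
    unfolding M_def N_def orth_compl_def
    using cinner_eq_zero_commute by blast
  have "\<not> norm_attaining_on Q M"
  proof
    assume "norm_attaining_on Q M"
    then obtain x where x: "x \<in> M" "norm x = 1" "norm (Q x) = norm_on Q M"
      by (auto simp: norm_attaining_on_def)
    define s where "s = norm_on Q M"
    have Qx: "Q x = s *\<^sub>R x"
      unfolding s_def by (rule maximising_vector_is_eigenvector[OF Q M x])
    have "\<mu> n \<le> s" for n
      using norm_le_norm_on[OF positive_operatorsD(1)[OF Q] reducing_subspacesD(1)[OF M] fM, of n]
      by (simp add: Qf nf s_def)
    then have "\<alpha> \<le> s"
      using lim by (intro LIMSEQ_le_const2[of \<mu>]) (auto simp: \<mu>_def[abs_def])
    have "cinner (f n) x = 0" for n
    proof -
      have "\<mu> n * cinner (f n) x = s * cinner (f n) x"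
        using positive_operatorsD(3)[OF Q, of "f n" x]
        by (simp add: Qf Qx cinner_scaleR_left cinner_scaleR_right)
      moreover have "\<mu> n \<noteq> s"
        using \<mu>(2)[of n] \<open>\<alpha> \<le> s\<close> by (simp add: \<mu>_def)
      ultimately show ?thesis
        by simp
    qed
    then have "x \<in> N"
      by (auto simp: N_def orth_compl_def)
    with x(1) have "cinner x x = 0"
      by (simp add: M_def orth_compl_def)
    with x(2) show False
      by (simp add: cinner_self)
  qed
  moreover have "M \<noteq> {0}"
    using fM[of 0] nf[of 0] by auto
  ultimately have "W \<notin> beta0"
    using M by (auto simp: beta0_def beta_def Q_def)
  with K show ?thesis
    by (auto simp: W_def[abs_def])
qed

text \<open>
  The eigenvalues \<open>l n\<close> of the maximal eigenvectors decrease to a limit \<open>\<alpha>\<close>, and \<open>\<alpha> > 0\<close> is refuted by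
  a perturbation along a subsequence.
\<close>

lemma beta0_hat_subset_compact_operators:
  assumes inf: "\<not> (\<exists>B :: 'a::complex_hilbert_space set. finite B \<and> cspan B = UNIV)"
  shows "beta0_hat \<subseteq> (compact_operators :: ('a \<Rightarrow> 'a) set)"
proof
  fix T :: "'a \<Rightarrow> 'a" assume hat: "T \<in> beta0_hat"
  then have T: "T \<in> bounded_operators" and "abs_op T \<in> beta"
    by (auto simp: beta0_hat_def beta0_def)
  define P where "P = abs_op T"
  have P: "P \<in> positive_operators" "P \<in> beta"
    using abs_op_spec(1)[OF T] \<open>abs_op T \<in> beta\<close> by (auto simp: P_def)
  obtain e :: "nat \<Rightarrow> 'a" where e: "\<And>i j. cinner (e i) (e j) = (if i = j then 1 else 0)"
    and eig: "\<And>n. P (e n) = norm (P (e n)) *\<^sub>R e n"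
    and bound: "\<And>n y. y \<in> orth_compl (e ` {..<n}) \<Longrightarrow> norm (P y) \<le> norm (P (e n)) * norm y"
    using eigenvector_sequence[OF P inf] by blast
  define l where "l n = norm (P (e n))" for n
  have "decseq l"
  proof (rule decseq_SucI)
    fix n
    have "e (Suc n) \<in> orth_compl (e ` {..<n})"
      by (auto simp: orth_compl_def e)
    from bound[OF this] show "l (Suc n) \<le> l n"
      by (simp add: l_def orthonormal_seqD(1)[OF e])
  qed
  then obtain \<alpha> where lim: "l \<longlonglongrightarrow> \<alpha>" and above: "\<And>n. \<alpha> \<le> l n"
    using decseq_convergent[of l 0] by (auto simp: l_def)
  have "\<alpha> \<ge> 0"
    by (rule LIMSEQ_le_const[OF lim]) (auto simp: l_def)
  show "T \<in> compact_operators"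
  proof (cases "\<alpha> = 0")
    case True
    show ?thesis
      by (rule compact_if_eigenvalues_tendsto_zero[OF T e])
        (use bound lim True in \<open>auto simp: P_def l_def norm_abs_op[OF T]\<close>)
  next
    case False
    with \<open>\<alpha> \<ge> 0\<close> have "\<alpha> > 0"
      by simp
    have "\<exists>k. \<forall>m\<ge>k. l m < \<alpha> + \<alpha> / 2 ^ n" for n
      using order_tendstoD(2)[OF lim, of "\<alpha> + \<alpha> / 2 ^ n"] \<open>\<alpha> > 0\<close>
      by (auto simp: eventually_sequentially)
    then obtain k where k: "\<And>n m. k n \<le> m \<Longrightarrow> l m < \<alpha> + \<alpha> / 2 ^ n"
      by metis
    \<comment> \<open>Partial sums give a strictly increasing \<open>r\<close> with \<open>r n \<ge> k n\<close>.\<close>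
    define r where "r n = (\<Sum>i\<le>n. Suc (k i))" for n
    have "strict_mono r"
      by (rule strict_monoI_Suc) (simp add: r_def)
    have k_le: "k n \<le> r n" for n
      using member_le_sum[of n "{..n}" "\<lambda>i. Suc (k i)"] by (simp add: r_def)
    define f where "f n = e (r n)" for n
    \<comment> \<open>The relative change that moves the eigenvalue \<open>l (r n)\<close> to \<open>\<alpha> * (1 - 1 / 2 ^ Suc n)\<close>. Both are
      within \<open>\<alpha> / 2 ^ n\<close> of \<open>\<alpha>\<close>, which makes \<open>d\<close> summable.\<close>
    define d where "d n = \<alpha> * (1 - 1 / 2 ^ Suc n) / l (r n) - 1" for n
    have l_pos: "l n > 0" for n
      using above[of n] \<open>\<alpha> > 0\<close> by simp
    have \<mu>: "(1 + d n) * l (r n) = \<alpha> * (1 - 1 / 2 ^ Suc n)" for n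
      using l_pos[of "r n"] by (simp add: d_def)
    have d_le: "\<bar>d n\<bar> \<le> 2 * (1 / 2) ^ n" for n
    proof -
      have "\<bar>d n\<bar> = (l (r n) - \<alpha> * (1 - 1 / 2 ^ Suc n)) / l (r n)"
      proof -
        have "\<alpha> * (1 - 1 / 2 ^ Suc n) \<le> \<alpha> * 1"
          using \<open>\<alpha> > 0\<close> by (intro mult_left_mono) auto
        with above[of "r n"] have "\<alpha> * (1 - 1 / 2 ^ Suc n) \<le> l (r n)"
          by simp
        then have "d n \<le> 0"
          using l_pos[of "r n"] unfolding d_def by (simp only: diff_le_0_iff_le divide_le_eq_1_pos)
        then show ?thesis
          using l_pos[of "r n"] by (simp add: d_def diff_divide_distrib)
      qed
      also have "\<dots> \<le> (2 * \<alpha> / 2 ^ n) / \<alpha>"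
      proof (rule frac_le)
        have "\<alpha> * (1 / 2 ^ Suc n) \<le> \<alpha> / 2 ^ n"
          using \<open>\<alpha> > 0\<close> by (simp add: field_simps)
        then show "l (r n) - \<alpha> * (1 - 1 / 2 ^ Suc n) \<le> 2 * \<alpha> / 2 ^ n"
          using k[OF k_le, of n] by (simp add: right_diff_distrib)
      qed (use \<open>\<alpha> > 0\<close> above in auto)
      finally show ?thesis
        using \<open>\<alpha> > 0\<close> by (simp add: power_one_over)
    qed
    have "\<exists>K\<in>compact_operators. (\<lambda>x. T x + K x) \<notin> beta0"
    proof (rule compact_perturbation_not_beta0[OF T])
      show "cinner (f i) (f j) = (if i = j then 1 else 0)" for i j
        using \<open>strict_mono r\<close> by (simp add: f_def e strict_mono_eq)
      show "abs_op T (f n) = l (r n) *\<^sub>R f n" for n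
        using eig[of "r n"] by (simp add: f_def l_def P_def)
      show "summable (\<lambda>n. \<bar>d n\<bar>)"
        by (rule summable_comparison_test'[OF summable_mult[OF summable_geometric[of "1/2"], of 2]])
          (use d_le in auto)
      show "0 \<le> (1 + d n) * l (r n)" for n
        unfolding \<mu> using \<open>\<alpha> > 0\<close> power_le_one[of "1 / 2 :: real" "Suc n"]
        by (intro mult_nonneg_nonneg) (simp_all add: power_one_over)
      show "(1 + d n) * l (r n) < \<alpha>" for n
        unfolding \<mu> using \<open>\<alpha> > 0\<close> by (simp add: field_simps)
      have "(\<lambda>n. \<alpha> * (1 - (1 / 2) ^ Suc n)) \<longlonglongrightarrow> \<alpha> * (1 - 0)"
        by (intro tendsto_intros LIMSEQ_Suc LIMSEQ_power_zero) auto
      then show "(\<lambda>n. (1 + d n) * l (r n)) \<longlonglongrightarrow> \<alpha>"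
        unfolding \<mu> by (simp add: power_one_over)
    qed
    with hat show ?thesis
      by (auto simp: beta0_hat_def)
  qed
qed

theorem theorem6p1:
  assumes separable: "separable_space (euclidean :: 'a::complex_hilbert_space topology)"
    and infinite_dimensional: "\<not> (\<exists>B :: 'a set. finite B \<and> cspan B = UNIV)"
  shows "beta0_hat = (compact_operators :: ('a \<Rightarrow> 'a) set)"
proof
  show "beta0_hat \<subseteq> (compact_operators :: ('a \<Rightarrow> 'a) set)"
    by (rule beta0_hat_subset_compact_operators[OF infinite_dimensional])
  show "compact_operators \<subseteq> (beta0_hat :: ('a \<Rightarrow> 'a) set)"
    using compact_operators_subset_beta0 compact_operators_add
    by (auto simp: beta0_hat_def)
qed

end
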